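(* Let $\mathcal{A}$ be a commutative, boundedly approximately amenable Banach algebra. If the underlying Banach space of $\mathcal{A}$ is reflexive, then $\mathcal{A}$ is finite-dimensional.
   Context: Banach algebras are over $\mathbb{C}$. For a Banach $\mathcal{A}$-bimodule $Y$ and $y\in Y$, $\operatorname{ad}_y:\mathcal{A}\to Y$ is the inner derivation $a\mapsto a\cdot y-y\cdot a$. A Banach algebra $\mathcal{A}$ is boundedly approximately amenable if, for every Banach $\mathcal{A}$-bimodule $X$ and every continuous derivation $D:\mathcal{A}\to X^*$, there is a net $(\xi_i)$ in $X^*$ such that the net $(\operatorname{ad}_{\xi_i})$ is bounded in operator norm and $D(a)=\lim_i \operatorname{ad}_{\xi_i}(a)$ in norm for every $a\in\mathcal{A}$. *)

theory Defs
  imports "HOL-Analysis.Analysis"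
begin

section \<open>Complex Banach algebras\<close>

text \<open>
  A Banach algebra is a type. No unit is assumed, and submultiplicativity of the norm comes from
  \<^class>\<open>real_normed_algebra\<close>.
\<close>

class complex_banach_algebra = real_normed_algebra + banach +
  fixes scaleC :: "complex \<Rightarrow> 'a \<Rightarrow> 'a"  (infixr "*\<^sub>C" 75)
  assumes scaleC_add_right: "c *\<^sub>C (x + y) = c *\<^sub>C x + c *\<^sub>C y"
    and scaleC_add_left: "(c + d) *\<^sub>C x = c *\<^sub>C x + d *\<^sub>C x"
    and scaleC_scaleC: "c *\<^sub>C (d *\<^sub>C x) = (c * d) *\<^sub>C x"
    and scaleR_scaleC: "r *\<^sub>R x = complex_of_real r *\<^sub>C x"
    and mult_scaleC_left: "(c *\<^sub>C x) * y = c *\<^sub>C (x * y)"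
    and mult_scaleC_right: "x * (c *\<^sub>C y) = c *\<^sub>C (x * y)"
    and norm_scaleC: "norm (c *\<^sub>C x) = cmod c * norm x"

interpretation complex_vector: vector_space "scaleC :: complex \<Rightarrow> 'a \<Rightarrow> 'a::complex_banach_algebra"
proof
  show "1 *\<^sub>C x = x" for x :: 'a
    using scaleR_scaleC[of 1 x] by simp
qed (simp_all add: scaleC_add_right scaleC_add_left scaleC_scaleC)

definition complex_finite_dimensional :: "'a::complex_banach_algebra itself \<Rightarrow> bool" where
  "complex_finite_dimensional _ \<longleftrightarrow>
     (\<exists>B::'a set. finite B \<and> module.span scaleC B = UNIV)"


section \<open>Complex Banach spaces on a carrier set\<close>

text \<open>
  Bimodules and their duals are quantified inside a formula, so they have to be values rather than
  types. The operations are unconstrained outside the carrier.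
\<close>

record 'x cspace =
  vcarrier :: "'x set"
  vadd :: "'x \<Rightarrow> 'x \<Rightarrow> 'x"
  vzero :: 'x
  vscale :: "complex \<Rightarrow> 'x \<Rightarrow> 'x"
  vnorm :: "'x \<Rightarrow> real"

definition vsub :: "('x, 'm) cspace_scheme \<Rightarrow> 'x \<Rightarrow> 'x \<Rightarrow> 'x" where
  "vsub X x y = vadd X x (vscale X (-1) y)"

locale complex_normed_space =
  fixes X :: "('x, 'm) cspace_scheme"
  assumes add_closed: "\<lbrakk>x \<in> vcarrier X; y \<in> vcarrier X\<rbrakk> \<Longrightarrow> vadd X x y \<in> vcarrier X"
    and zero_closed: "vzero X \<in> vcarrier X"
    and scale_closed: "x \<in> vcarrier X \<Longrightarrow> vscale X c x \<in> vcarrier X"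
    and add_assoc: "\<lbrakk>x \<in> vcarrier X; y \<in> vcarrier X; z \<in> vcarrier X\<rbrakk>
          \<Longrightarrow> vadd X (vadd X x y) z = vadd X x (vadd X y z)"
    and add_commute: "\<lbrakk>x \<in> vcarrier X; y \<in> vcarrier X\<rbrakk> \<Longrightarrow> vadd X x y = vadd X y x"
    and add_zero: "x \<in> vcarrier X \<Longrightarrow> vadd X x (vzero X) = x"
    and add_inverse: "x \<in> vcarrier X \<Longrightarrow> vadd X x (vscale X (-1) x) = vzero X"
    and scale_add_right: "\<lbrakk>x \<in> vcarrier X; y \<in> vcarrier X\<rbrakk>
          \<Longrightarrow> vscale X c (vadd X x y) = vadd X (vscale X c x) (vscale X c y)"
    and scale_add_left: "x \<in> vcarrier X
          \<Longrightarrow> vscale X (c + d) x = vadd X (vscale X c x) (vscale X d x)"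
    and scale_scale: "x \<in> vcarrier X \<Longrightarrow> vscale X c (vscale X d x) = vscale X (c * d) x"
    and scale_one: "x \<in> vcarrier X \<Longrightarrow> vscale X 1 x = x"
    and norm_nonneg: "x \<in> vcarrier X \<Longrightarrow> 0 \<le> vnorm X x"
    and norm_eq_zero: "x \<in> vcarrier X \<Longrightarrow> vnorm X x = 0 \<longleftrightarrow> x = vzero X"
    and norm_triangle: "\<lbrakk>x \<in> vcarrier X; y \<in> vcarrier X\<rbrakk>
          \<Longrightarrow> vnorm X (vadd X x y) \<le> vnorm X x + vnorm X y"
    and norm_scale: "x \<in> vcarrier X \<Longrightarrow> vnorm X (vscale X c x) = cmod c * vnorm X x"

text \<open>
  \<^locale>\<open>Metric_space\<close> requires nonnegativity and symmetry on the whole type, hence the case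
  distinction.
\<close>

definition vdist :: "('x, 'm) cspace_scheme \<Rightarrow> 'x \<Rightarrow> 'x \<Rightarrow> real" where
  "vdist X x y = (if x \<in> vcarrier X \<and> y \<in> vcarrier X then vnorm X (vsub X x y) else 0)"

definition vtopology :: "('x, 'm) cspace_scheme \<Rightarrow> 'x topology" where
  "vtopology X = Metric_space.mtopology (vcarrier X) (vdist X)"

lemma (in complex_normed_space) Metric_space_vdist: "Metric_space (vcarrier X) (vdist X)"
proof
  have sub: "vsub X x y \<in> vcarrier X" if "x \<in> vcarrier X" "y \<in> vcarrier X" for x y
    using that by (simp add: vsub_def add_closed scale_closed)
  have cancel: "vadd X (vsub X x y) y = x" if xy: "x \<in> vcarrier X" "y \<in> vcarrier X" for x y
  proof -
    have "vadd X (vsub X x y) y = vadd X x (vadd X (vscale X (-1) y) y)"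
      using xy by (simp add: vsub_def add_assoc scale_closed)
    also have "vadd X (vscale X (-1) y) y = vzero X"
      using xy by (metis add_commute add_inverse scale_closed)
    finally show ?thesis using xy by (simp add: add_zero)
  qed
  show "0 \<le> vdist X x y" for x y
    by (simp add: vdist_def norm_nonneg sub)
  show "vdist X x y = vdist X y x" for x y
  proof (cases "x \<in> vcarrier X \<and> y \<in> vcarrier X")
    case True
    then have "vsub X y x = vscale X (-1) (vsub X x y)"
      by (simp add: vsub_def scale_add_right scale_closed scale_scale scale_one add_commute)
    with True sub show ?thesis by (simp add: vdist_def norm_scale)
  qed (auto simp: vdist_def)
  show "vdist X x y = 0 \<longleftrightarrow> x = y" if xy: "x \<in> vcarrier X" "y \<in> vcarrier X" for x y
  proof -
    have "vsub X x y = vzero X \<Longrightarrow> x = y"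
      using cancel[OF xy] xy by (metis add_commute add_zero zero_closed)
    moreover have "vsub X x x = vzero X" using xy by (simp add: vsub_def add_inverse)
    ultimately show ?thesis using xy sub by (auto simp: vdist_def norm_eq_zero)
  qed
  show "vdist X x z \<le> vdist X x y + vdist X y z"
    if xyz: "x \<in> vcarrier X" "y \<in> vcarrier X" "z \<in> vcarrier X" for x y z
  proof -
    have "vsub X x z = vadd X (vadd X (vsub X x y) y) (vscale X (-1) z)"
      using xyz cancel by (simp add: vsub_def)
    also have "\<dots> = vadd X (vsub X x y) (vsub X y z)"
      unfolding vsub_def[of X y z] using xyz sub by (intro add_assoc) (auto simp: scale_closed)
    finally show ?thesis using xyz sub norm_triangle by (simp add: vdist_def)
  qed
qed

locale complex_banach_space = complex_normed_space X
  for X :: "('x, 'm) cspace_scheme" +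
  assumes complete: "Metric_space.mcomplete (vcarrier X) (vdist X)"

text \<open>
  Functionals in the dual vanish outside the carrier, so that equality of functions is equality of
  functionals. The quotient at the zero vector is \<open>0 / 0 = 0\<close>, as in \<^const>\<open>onorm\<close>.
\<close>

definition dual_cspace :: "('x, 'm) cspace_scheme \<Rightarrow> ('x \<Rightarrow> complex) cspace" where
  "dual_cspace X =
     \<lparr>vcarrier = {f.
         (\<forall>x\<in>vcarrier X. \<forall>y\<in>vcarrier X. f (vadd X x y) = f x + f y) \<and>
         (\<forall>c. \<forall>x\<in>vcarrier X. f (vscale X c x) = c * f x) \<and>
         (\<exists>C. \<forall>x\<in>vcarrier X. cmod (f x) \<le> C * vnorm X x) \<and>
         (\<forall>x. x \<notin> vcarrier X \<longrightarrow> f x = 0)},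
      vadd = (\<lambda>f g x. f x + g x),
      vzero = (\<lambda>x. 0),
      vscale = (\<lambda>c f x. c * f x),
      vnorm = (\<lambda>f. SUP x\<in>vcarrier X. cmod (f x) / vnorm X x)\<rparr>"

definition reflexive_cspace :: "('x, 'm) cspace_scheme \<Rightarrow> bool" where
  "reflexive_cspace X \<longleftrightarrow>
     (\<forall>\<Phi> \<in> vcarrier (dual_cspace (dual_cspace X)).
        \<exists>x \<in> vcarrier X. \<forall>f \<in> vcarrier (dual_cspace X). \<Phi> f = f x)"

definition cspace_of :: "'a::complex_banach_algebra itself \<Rightarrow> 'a cspace" where
  "cspace_of _ = \<lparr>vcarrier = UNIV, vadd = (+), vzero = 0, vscale = scaleC, vnorm = norm\<rparr>"


section \<open>Bimodules and derivations\<close>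

record ('a, 'x) bimod = "'x cspace" +
  lact :: "'a \<Rightarrow> 'x \<Rightarrow> 'x"
  ract :: "'x \<Rightarrow> 'a \<Rightarrow> 'x"

locale banach_bimodule = complex_banach_space X
  for X :: "('a::complex_banach_algebra, 'x) bimod" +
  assumes lact_closed: "x \<in> vcarrier X \<Longrightarrow> lact X a x \<in> vcarrier X"
    and ract_closed: "x \<in> vcarrier X \<Longrightarrow> ract X x a \<in> vcarrier X"
    and lact_add_left: "x \<in> vcarrier X \<Longrightarrow> lact X (a + b) x = vadd X (lact X a x) (lact X b x)"
    and lact_scale_left: "x \<in> vcarrier X \<Longrightarrow> lact X (c *\<^sub>C a) x = vscale X c (lact X a x)"
    and lact_add_right: "\<lbrakk>x \<in> vcarrier X; y \<in> vcarrier X\<rbrakk>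
          \<Longrightarrow> lact X a (vadd X x y) = vadd X (lact X a x) (lact X a y)"
    and lact_scale_right: "x \<in> vcarrier X \<Longrightarrow> lact X a (vscale X c x) = vscale X c (lact X a x)"
    and ract_add_right: "x \<in> vcarrier X \<Longrightarrow> ract X x (a + b) = vadd X (ract X x a) (ract X x b)"
    and ract_scale_right: "x \<in> vcarrier X \<Longrightarrow> ract X x (c *\<^sub>C a) = vscale X c (ract X x a)"
    and ract_add_left: "\<lbrakk>x \<in> vcarrier X; y \<in> vcarrier X\<rbrakk>
          \<Longrightarrow> ract X (vadd X x y) a = vadd X (ract X x a) (ract X y a)"
    and ract_scale_left: "x \<in> vcarrier X \<Longrightarrow> ract X (vscale X c x) a = vscale X c (ract X x a)"
    and lact_mult: "x \<in> vcarrier X \<Longrightarrow> lact X (a * b) x = lact X a (lact X b x)"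
    and ract_mult: "x \<in> vcarrier X \<Longrightarrow> ract X x (a * b) = ract X (ract X x a) b"
    and lact_ract: "x \<in> vcarrier X \<Longrightarrow> ract X (lact X a x) b = lact X a (ract X x b)"
    and lact_bounded: "\<exists>C. \<forall>a. \<forall>x\<in>vcarrier X. vnorm X (lact X a x) \<le> C * norm a * vnorm X x"
    and ract_bounded: "\<exists>C. \<forall>a. \<forall>x\<in>vcarrier X. vnorm X (ract X x a) \<le> C * norm a * vnorm X x"

text \<open>The dual actions are \<open>(a \<cdot> f)(x) = f(x \<cdot> a)\<close> and \<open>(f \<cdot> a)(x) = f(a \<cdot> x)\<close>.\<close>

definition dual_bimod :: "('a, 'x) bimod \<Rightarrow> ('a, 'x \<Rightarrow> complex) bimod" where
  "dual_bimod X = cspace.extend (dual_cspace X)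
     (bimod.fields
       (\<lambda>a f x. if x \<in> vcarrier X then f (ract X x a) else 0)
       (\<lambda>f a x. if x \<in> vcarrier X then f (lact X a x) else 0))"

definition continuous_derivation ::
    "('a::complex_banach_algebra, 'x) bimod \<Rightarrow> ('a \<Rightarrow> 'x) \<Rightarrow> bool" where
  "continuous_derivation Y D \<longleftrightarrow>
     (\<forall>a. D a \<in> vcarrier Y) \<and>
     (\<forall>a b. D (a + b) = vadd Y (D a) (D b)) \<and>
     (\<forall>c a. D (c *\<^sub>C a) = vscale Y c (D a)) \<and>
     (\<forall>a b. D (a * b) = vadd Y (lact Y a (D b)) (ract Y (D a) b)) \<and>
     continuous_map euclidean (vtopology Y) D"

definition inner_derivation :: "('a, 'x) bimod \<Rightarrow> 'x \<Rightarrow> 'a \<Rightarrow> 'x" where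
  "inner_derivation Y y a = vsub Y (lact Y a y) (ract Y y a)"

text \<open>The operator norm, as in \<^const>\<open>onorm\<close>, for maps into a carrier-based space.\<close>

definition op_norm :: "('x, 'm) cspace_scheme \<Rightarrow> ('a::real_normed_vector \<Rightarrow> 'x) \<Rightarrow> real" where
  "op_norm Y T = (SUP a. vnorm Y (T a) / norm a)"


section \<open>Bounded approximate amenability\<close>

text \<open>
  A net in the dual is given by the filter of its tails: a net yields the filter generated by its
  tails, and a proper filter containing the dual is the tail filter of the net of pairs
  \<open>(S, \<xi>)\<close> with \<open>\<xi> \<in> S\<close> and \<open>S\<close> in the filter, ordered by reverse inclusion of \<open>S\<close>. All
  conditions below are conditions on tails (a net with bounded tail can be replaced by that tail),
  so both formulations agree.
\<close>

definition boundedly_approximately_inner ::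
    "('a::complex_banach_algebra, 'x) bimod \<Rightarrow> ('a \<Rightarrow> 'x) \<Rightarrow> bool" where
  "boundedly_approximately_inner Y D \<longleftrightarrow>
     (\<exists>F::'x filter. F \<noteq> bot \<and>
        (\<forall>\<^sub>F \<xi> in F. \<xi> \<in> vcarrier Y) \<and>
        (\<exists>C. \<forall>\<^sub>F \<xi> in F. op_norm Y (inner_derivation Y \<xi>) \<le> C) \<and>
        (\<forall>a. limitin (vtopology Y) (\<lambda>\<xi>. inner_derivation Y \<xi> a) (D a) F))"

definition boundedly_approximately_amenable_over ::
    "'x itself \<Rightarrow> 'a::complex_banach_algebra itself \<Rightarrow> bool" where
  "boundedly_approximately_amenable_over _ _ \<longleftrightarrow>
     (\<forall>X::('a, 'x) bimod. banach_bimodule X \<longrightarrow>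
        (\<forall>D. continuous_derivation (dual_bimod X) D
           \<longrightarrow> boundedly_approximately_inner (dual_bimod X) D))"

text \<open>
  HOL cannot quantify over all types inside a formula, so ``every Banach bimodule'' has to mean
  every bimodule whose carrier is a set of elements of one fixed type, depending on the algebra
  \<open>A\<close>. The type below has cardinality \<open>2^(2^\<kappa>)\<close> for \<open>\<kappa> = max(|A|, 2^\<aleph>\<^sub>0)\<close>; it
  consists of the functions on the scalar-valued forms on the unitization of \<open>A\<close>, so \<open>A\<close>, its
  iterated duals up to the second, and the projective tensor square of the unitization have copies
  in it.

  The choice loses nothing: the condition over this type implies the condition for a bimodule \<open>X\<close>
  of any size. Suppose \<open>D : A \<rightarrow> X*\<close> is not the limit of a bounded net of inner derivations. Then
  for every \<open>K \<in> \<nat>\<close> there are a finite \<open>F \<subseteq> A\<close> and \<open>\<epsilon> > 0\<close> such that no \<open>\<xi> \<in> X*\<close> satisfies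
  both \<open>\<parallel>ad \<xi>\<parallel> \<le> K\<close> and \<open>\<parallel>D a - ad \<xi> a\<parallel> < \<epsilon>\<close> for all \<open>a \<in> F\<close>. For a given \<open>\<xi>\<close> this failure
  is witnessed, up to replacing \<open>\<epsilon>\<close> by \<open>\<epsilon>/2\<close>, by one vector \<open>x\<close> in the unit ball of \<open>X\<close>, and the
  witnessing condition is weak* open in \<open>\<xi>\<close>. By weak* compactness finitely many witnesses serve all
  \<open>\<xi>\<close> with \<open>\<parallel>\<xi>\<parallel> \<le> n\<close>, hence countably many serve all \<open>K\<close> and \<open>n\<close>. The closed sub-bimodule
  \<open>X\<^sub>0\<close> generated by them has at most \<open>\<kappa>^\<aleph>\<^sub>0 \<le> 2^\<kappa>\<close> elements, so it has a copy carried by the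
  type. As every functional on \<open>X\<^sub>0\<close> extends to \<open>X\<close> by Hahn-Banach, the derivation into \<open>X\<^sub>0*\<close>
  induced by \<open>D\<close> is not such a limit either.
\<close>

type_synonym 'a bimod_universe = "('a \<times> complex \<Rightarrow> 'a \<times> complex \<Rightarrow> complex) \<Rightarrow> complex"

definition boundedly_approximately_amenable :: "'a::complex_banach_algebra itself \<Rightarrow> bool" where
  "boundedly_approximately_amenable A \<longleftrightarrow>
     boundedly_approximately_amenable_over TYPE('a bimod_universe) A"

end

theory Submission
  imports Defs "HOL-Complex_Analysis.Complex_Analysis"
begin

text \<open>
  Let \<open>I\<close> be \<open>A\<close> itself or the kernel of a character \<open>\<phi>\<close> of \<open>A\<close>. Approximating the derivation
  \<open>a \<mapsto> a \<otimes> 1 - 1 \<otimes> a\<close> by bounded inner derivations in the second dual of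
  \<open>I \<otimes> 1 + 1 \<otimes> I + I \<otimes> I\<close> yields elements \<open>u\<close> of \<open>I\<close>, by reflexivity, which form a
  multiplier-bounded approximate identity and satisfy
  \<open>\<parallel>a\<parallel> \<parallel>e u\<parallel> \<le> L \<parallel>a\<parallel> + c \<parallel>e a\<parallel> + \<parallel>a n\<parallel>\<close> for \<open>a\<close> in \<open>I\<close>, where only \<open>c\<close> and \<open>n\<close> depend on \<open>u\<close>
  and \<open>e\<close>. If these elements converge in norm, their limit is a unit of \<open>I\<close>. Otherwise differences
  of late members serve as elements \<open>a\<close> that are bounded away from zero and almost annihilate \<open>e\<close>
  and \<open>n\<close>, so that \<open>\<parallel>u\<parallel> \<le> L\<close>, and a weak limit is a unit of \<open>I\<close>.

  Hence \<open>A\<close> has a unit \<open>1\<close>, every \<open>ker \<phi>\<close> has a unit \<open>w\<close>, and \<open>q = 1 - w\<close> satisfies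
  \<open>a q = \<phi>(a) q\<close>. The span of all such \<open>q\<close> is an ideal on which no character vanishes, so by
  Gelfand-Mazur it contains \<open>1\<close>, which is then a combination of finitely many of them.
\<close>

section \<open>The Hahn-Banach theorem\<close>

text \<open>The obstacle is that the hypothesis bounds the maps \<open>ad \<xi>\<close> and not the
  functionals \<xi>, so the elements u may be unbounded and reflexivity yields no weak limit of
  them. The inequality with L comes from testing \<open>ad \<xi>\<close> at a on a rank-one form f
  \<otimes> g. One of the resulting terms is g(a) f(u). If g norms a, and f is h(e x) with h norming
  e u, this term is the product of the norms of a and e u. All the others are controlled by K or
  shrink with e a and a n. Since e is itself a member of the approximate identity, it is bounded as
  a multiplier, which bounds f even if e has large norm; the two uses of K give the square in L.

  Amenability is never transferred from A to an ideal. Instead A acts on I + C1 by a 1 = p(a) +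
  \<phi>(a) 1, where p projects onto I. For \<phi> = 0 this is the unitization of A, so one argument
  serves A and the kernels, and the hypothesis is always applied to A itself. The module is given
  through its predual, consisting of two functionals and a bilinear form, so that no tensor product
  has to be constructed.\<close>

definition sublinear :: "('v::real_vector \<Rightarrow> real) \<Rightarrow> bool" where
  "sublinear q \<longleftrightarrow> (\<forall>x y. q (x + y) \<le> q x + q y) \<and> (\<forall>r x. 0 \<le> r \<longrightarrow> q (r *\<^sub>R x) = r * q x)"

lemma sublinearI:
  assumes "\<And>x y. q (x + y) \<le> q x + q y" "\<And>r x. 0 < r \<Longrightarrow> q (r *\<^sub>R x) \<le> r * q x" "q 0 = 0"
  shows "sublinear q"
  unfolding sublinear_def
proof (intro conjI allI impI)
  fix r :: real and x assume "0 \<le> r"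
  show "q (r *\<^sub>R x) = r * q x"
  proof (cases "r = 0")
    case False
    with \<open>0 \<le> r\<close> have r: "0 < r" by simp
    have "q x \<le> (1 / r) * q (r *\<^sub>R x)"
      using assms(2)[of "1 / r" "r *\<^sub>R x"] r by simp
    with r have "r * q x \<le> q (r *\<^sub>R x)" by (simp add: field_simps)
    with assms(2)[OF r, of x] show ?thesis by simp
  qed (simp add: assms(3))
qed (rule assms(1))

lemma sublinear_add: "sublinear q \<Longrightarrow> q (x + y) \<le> q x + q y"
  and sublinear_scale: "sublinear q \<Longrightarrow> 0 \<le> r \<Longrightarrow> q (r *\<^sub>R x) = r * q x"
  and sublinear_zero: "sublinear q \<Longrightarrow> q 0 = 0"
  unfolding sublinear_def by (metis order_refl scaleR_zero_left mult_zero_left)+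

lemma sublinear_lower: "sublinear q \<Longrightarrow> - q (- x) \<le> q x"
  using sublinear_add[of q x "- x"] sublinear_zero[of q] by simp

text \<open>Every member lies above \<open>- q0 (- x)\<close>, which keeps the pointwise infimum
  finite. In a chain one member can be nearly optimal at two points at once, and this gives
  subadditivity.\<close>

lemma sublinear_Inf_chain:
  fixes C :: "('v::real_vector \<Rightarrow> real) set"
  assumes ne: "C \<noteq> {}" and sub: "\<And>q. q \<in> C \<Longrightarrow> sublinear q \<and> (\<forall>x. q x \<le> q0 x)"
    and q0: "sublinear q0"
    and chain: "\<And>q q'. q \<in> C \<Longrightarrow> q' \<in> C \<Longrightarrow> (\<forall>x. q x \<le> q' x) \<or> (\<forall>x. q' x \<le> q x)"
  shows "sublinear (\<lambda>x. INF q\<in>C. q x)" and "q \<in> C \<Longrightarrow> (INF q\<in>C. q x) \<le> q x"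
proof -
  have bdd: "bdd_below ((\<lambda>q. q x) ` C)" for x
  proof (rule bdd_belowI2)
    fix q assume "q \<in> C"
    then show "- q0 (- x) \<le> q x"
      using sublinear_lower[of q x] sub[of q] by (smt (verit))
  qed
  show le: "(INF q\<in>C. q x) \<le> q x" if "q \<in> C" for q x
    using that bdd by (rule cINF_lower[rotated])
  show "sublinear (\<lambda>x. INF q\<in>C. q x)"
  proof (rule sublinearI)
    fix x y
    show "(INF q\<in>C. q (x + y)) \<le> (INF q\<in>C. q x) + (INF q\<in>C. q y)"
    proof (rule field_le_epsilon)
      fix e :: real assume e: "0 < e"
      obtain q1 where q1: "q1 \<in> C" "q1 x < (INF q\<in>C. q x) + e / 2"
        using cInf_lessD[of "(\<lambda>q. q x) ` C" "(INF q\<in>C. q x) + e / 2"] ne e by auto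
      obtain q2 where q2: "q2 \<in> C" "q2 y < (INF q\<in>C. q y) + e / 2"
        using cInf_lessD[of "(\<lambda>q. q y) ` C" "(INF q\<in>C. q y) + e / 2"] ne e by auto
      obtain q3 where q3: "q3 \<in> C" "q3 x \<le> q1 x" "q3 y \<le> q2 y"
        using chain[OF q1(1) q2(1)] q1(1) q2(1) by (meson order_refl)
      have "(INF q\<in>C. q (x + y)) \<le> q3 x + q3 y"
        using le[OF q3(1), of "x + y"] sub[OF q3(1)] sublinear_add[of q3 x y] by linarith
      then show "(INF q\<in>C. q (x + y)) \<le> (INF q\<in>C. q x) + (INF q\<in>C. q y) + e"
        using q1 q2 q3 by linarith
    qed
  next
    fix r :: real and x assume r: "0 < r"
    have "(1 / r) * (INF q\<in>C. q (r *\<^sub>R x)) \<le> (INF q\<in>C. q x)"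
    proof (rule cINF_greatest[OF ne])
      fix q assume q: "q \<in> C"
      then have "(INF q\<in>C. q (r *\<^sub>R x)) \<le> r * q x"
        using le[OF q, of "r *\<^sub>R x"] sub[OF q] sublinear_scale[of q r x] r by simp
      then show "(1 / r) * (INF q\<in>C. q (r *\<^sub>R x)) \<le> q x" using r by (simp add: field_simps)
    qed
    then show "(INF q\<in>C. q (r *\<^sub>R x)) \<le> r * (INF q\<in>C. q x)" using r by (simp add: field_simps)
  next
    have "(\<lambda>q. q 0) ` C = {0}" using ne sub sublinear_zero by fastforce
    then show "(INF q\<in>C. q 0) = 0" by simp
  qed
qed

text \<open>An infimal convolution with two uses: with a ray and \<open>h = - q\<close> it proves
  minimal functionals additive, and with a subspace and \<open>h = - f\<close> it encodes the
  extension problem. As a ray must be allowed, \<open>M\<close> is only a convex cone. The condition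
  \<open>- h m \<le> q m\<close> keeps the infimum finite.\<close>

lemma sublinear_shift:
  assumes q: "sublinear q" and lower: "\<And>m. m \<in> M \<Longrightarrow> - h m \<le> q m"
    and M: "0 \<in> M" "\<And>m n. m \<in> M \<Longrightarrow> n \<in> M \<Longrightarrow> m + n \<in> M" "\<And>r m. 0 \<le> r \<Longrightarrow> m \<in> M \<Longrightarrow> r *\<^sub>R m \<in> M"
    and h: "\<And>m n. m \<in> M \<Longrightarrow> n \<in> M \<Longrightarrow> h (m + n) = h m + h n"
           "\<And>r m. 0 \<le> r \<Longrightarrow> m \<in> M \<Longrightarrow> h (r *\<^sub>R m) = r * h m"
  shows "sublinear (\<lambda>x. INF m\<in>M. q (x + m) + h m)"
    and "m \<in> M \<Longrightarrow> (INF m\<in>M. q (x + m) + h m) \<le> q (x + m) + h m"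
proof -
  let ?Q = "\<lambda>x. INF m\<in>M. q (x + m) + h m"
  have bdd: "bdd_below ((\<lambda>m. q (x + m) + h m) ` M)" for x
  proof (rule bdd_belowI2)
    fix m assume m: "m \<in> M"
    have "q m \<le> q (x + m) + q (- x)" using sublinear_add[OF q, of "x + m" "- x"] by simp
    with lower[OF m] show "- q (- x) \<le> q (x + m) + h m" by linarith
  qed
  show le: "?Q x \<le> q (x + m) + h m" if "m \<in> M" for m x
    using that bdd by (rule cINF_lower[rotated])
  have ne: "M \<noteq> {}" using M(1) by auto
  have h0: "h 0 = 0" using h(2)[of 0 0] M(1) by simp
  show "sublinear ?Q"
  proof (rule sublinearI)
    fix x y
    show "?Q (x + y) \<le> ?Q x + ?Q y"
    proof (rule field_le_epsilon)
      fix e :: real assume e: "0 < e"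
      obtain m where m: "m \<in> M" "q (x + m) + h m < ?Q x + e / 2"
        using cInf_lessD[of "(\<lambda>m. q (x + m) + h m) ` M" "?Q x + e / 2"] ne e by auto
      obtain n where n: "n \<in> M" "q (y + n) + h n < ?Q y + e / 2"
        using cInf_lessD[of "(\<lambda>m. q (y + m) + h m) ` M" "?Q y + e / 2"] ne e by auto
      have "?Q (x + y) \<le> q ((x + m) + (y + n)) + h (m + n)"
        using le[OF M(2)[OF m(1) n(1)], of "x + y"] by (simp add: algebra_simps)
      also have "\<dots> \<le> q (x + m) + q (y + n) + (h m + h n)"
        using sublinear_add[OF q, of "x + m" "y + n"] h(1)[OF m(1) n(1)] by linarith
      finally show "?Q (x + y) \<le> ?Q x + ?Q y + e" using m n by linarith
    qed
  next
    fix r :: real and x assume r: "0 < r"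
    have "(1 / r) * ?Q (r *\<^sub>R x) \<le> ?Q x"
    proof (rule cINF_greatest[OF ne])
      fix m assume m: "m \<in> M"
      have "?Q (r *\<^sub>R x) \<le> q (r *\<^sub>R (x + m)) + h (r *\<^sub>R m)"
        using le[OF M(3)[of r m], of "r *\<^sub>R x"] m r by (simp add: scaleR_add_right)
      also have "\<dots> = r * (q (x + m) + h m)"
        using sublinear_scale[OF q, of r "x + m"] h(2)[of r m] m r by (simp add: algebra_simps)
      finally show "(1 / r) * ?Q (r *\<^sub>R x) \<le> q (x + m) + h m" using r by (simp add: field_simps)
    qed
    then show "?Q (r *\<^sub>R x) \<le> r * ?Q x" using r by (simp add: field_simps)
  next
    show "?Q 0 = 0"
    proof (rule antisym)
      show "?Q 0 \<le> 0" using le[OF M(1), of 0] h0 sublinear_zero[OF q] by simp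
      show "0 \<le> ?Q 0" using lower by (intro cINF_greatest[OF ne]) (smt (verit) add_0)
    qed
  qed
qed

text \<open>
  A minimal sublinear functional \<open>q\<close> is additive because \<open>x \<mapsto> (INF t\<ge>0. q (x + t y) - t q y)\<close> is
  sublinear and lies below it.
\<close>

lemma linear_below_sublinear:
  fixes q0 :: "'v::real_vector \<Rightarrow> real"
  assumes q0: "sublinear q0"
  obtains F where "linear F" "\<And>x. F x \<le> q0 x"
proof -
  let ?A = "{q. sublinear q \<and> (\<forall>x. q x \<le> q0 x)}"
  \<comment> \<open>The order is reversed, so that the maximal element from Zorn's lemma is a
    minimal functional.\<close>
  let ?P = "\<lambda>q q'. \<forall>x. q' x \<le> (q x :: real)"
  have po: "partial_order_on ?A (relation_of ?P ?A)"
  proof (rule partial_order_on_relation_ofI)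
    show "?P q q''" if "?P q q'" "?P q' q''" for q q' q'' :: "'v \<Rightarrow> real"
      using that by (meson order_trans)
    show "q = q'" if "?P q q'" "?P q' q" for q q' :: "'v \<Rightarrow> real"
      using that by (intro ext antisym) auto
  qed simp
  have "\<exists>m\<in>?A. \<forall>q\<in>?A. ?P m q \<longrightarrow> q = m"
  proof (rule predicate_Zorn[OF po])
    fix C assume C: "C \<in> Chains (relation_of ?P ?A)"
    then have sub: "q \<in> C \<Longrightarrow> sublinear q \<and> (\<forall>x. q x \<le> q0 x)"
      and chain: "q \<in> C \<Longrightarrow> q' \<in> C \<Longrightarrow> (\<forall>x. q x \<le> q' x) \<or> (\<forall>x. q' x \<le> q x)" for q q'
      by (auto simp: Chains_def relation_of_def)
    show "\<exists>u\<in>?A. \<forall>q\<in>C. ?P q u"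
    proof (cases "C = {}")
      case False
      then obtain q where q: "q \<in> C" by auto
      have inf: "sublinear (\<lambda>x. INF q\<in>C. q x)" "\<And>q x. q \<in> C \<Longrightarrow> (INF q\<in>C. q x) \<le> q x"
        by (rule sublinear_Inf_chain[OF False _ q0]; use sub chain in blast)+
      then have "(\<lambda>x. INF q\<in>C. q x) \<in> ?A"
        using sub[OF q] q by (auto intro: order_trans)
      with inf(2) show ?thesis by (intro bexI[of _ "\<lambda>x. INF q\<in>C. q x"]) auto
    qed (use q0 in auto)
  qed
  then obtain q where q: "sublinear q" "\<And>x. q x \<le> q0 x"
    and max: "\<forall>q'\<in>?A. ?P q q' \<longrightarrow> q' = q" by auto
  have min: "q' = q" if "sublinear q'" "\<And>x. q' x \<le> q x" for q'
  proof -
    have "q' x \<le> q0 x" for x using that(2)[of x] q(2)[of x] by linarith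
    with that max show ?thesis by auto
  qed
  have add: "q (x + y) = q x + q y" for x y
  proof -
    let ?M = "{t *\<^sub>R y |t. 0 \<le> t}" and ?h = "\<lambda>m. - q m"
    have M: "0 \<in> ?M" "\<And>m n. m \<in> ?M \<Longrightarrow> n \<in> ?M \<Longrightarrow> m + n \<in> ?M"
      "\<And>r m. 0 \<le> r \<Longrightarrow> m \<in> ?M \<Longrightarrow> r *\<^sub>R m \<in> ?M"
      subgoal by (force intro: exI[of _ 0])
      subgoal by (auto simp flip: scaleR_add_left)
      subgoal by auto
      done
    have h: "?h (m + n) = ?h m + ?h n" if "m \<in> ?M" "n \<in> ?M" for m n
    proof -
      obtain s t where st: "m = s *\<^sub>R y" "0 \<le> s" "n = t *\<^sub>R y" "0 \<le> t" using \<open>m \<in> ?M\<close> \<open>n \<in> ?M\<close> by auto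
      have "q ((s + t) *\<^sub>R y) = (s + t) * q y" using sublinear_scale[OF q(1)] st by simp
      with st show ?thesis
        using sublinear_scale[OF q(1)] by (simp add: algebra_simps)
    qed
    have h': "- ?h m \<le> q m" "0 \<le> r \<Longrightarrow> ?h (r *\<^sub>R m) = r * ?h m" for r m
      by (simp_all add: sublinear_scale[OF q(1)])
    let ?Q = "\<lambda>x. INF m\<in>?M. q (x + m) + ?h m"
    have 1: "sublinear ?Q"
      by (rule sublinear_shift(1)[OF q(1) h'(1) M h h'(2)])
    have 2: "?Q x \<le> q (x + m) + ?h m" if "m \<in> ?M" for x m
      by (rule sublinear_shift(2)[OF q(1) h'(1) M h h'(2) that])
    have "?Q = q"
      by (rule min[OF 1]) (use 2[OF M(1)] sublinear_zero[OF q(1)] in auto)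
    then have "?Q x = q x" by (rule fun_cong)
    \<comment> \<open>The choice t = 1 in the infimum gives
      \<open>q x \<le> q (x + y) - q y\<close>, the missing half of additivity.\<close>
    moreover have "y \<in> ?M" by (force intro: exI[of _ 1])
    ultimately show ?thesis using 2[of y x] sublinear_add[OF q(1), of x y] by linarith
  qed
  have neg: "q (- x) = - q x" for x
    using add[of x "- x"] sublinear_zero[OF q(1)] by simp
  have "linear q"
  proof (rule linearI[OF add])
    fix r x
    show "q (r *\<^sub>R x) = r *\<^sub>R q x"
      using sublinear_scale[OF q(1), of r x] sublinear_scale[OF q(1), of "- r" x] neg[of "r *\<^sub>R x"]
      by (cases "0 \<le> r") auto
  qed
  then show ?thesis using q(2) that by blast
qed

text \<open>On \<open>W\<close> the choice \<open>m = - x\<close> gives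
  \<open>?Q x \<le> f x\<close>. A linear functional below \<open>?Q\<close> is therefore at most
  \<open>f\<close> on \<open>W\<close>, and comparison at x and - x forces equality. This replaces
  the extension by one dimension at a time.\<close>

theorem real_Hahn_Banach:
  fixes q :: "'v::real_vector \<Rightarrow> real"
  assumes q: "sublinear q" and W: "subspace W"
    and add: "\<And>x y. x \<in> W \<Longrightarrow> y \<in> W \<Longrightarrow> f (x + y) = f x + f y"
    and scale: "\<And>r x. x \<in> W \<Longrightarrow> f (r *\<^sub>R x) = r * f x"
    and le: "\<And>x. x \<in> W \<Longrightarrow> f x \<le> q x"
  obtains F where "linear F" "\<And>x. F x \<le> q x" "\<And>x. x \<in> W \<Longrightarrow> F x = f x"
proof -
  let ?Q = "\<lambda>x. INF m\<in>W. q (x + m) + - f m"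
  have neg: "f (- m) = - f m" if "m \<in> W" for m using scale[OF that, of "-1"] by simp
  have W': "0 \<in> W" "\<And>m n. m \<in> W \<Longrightarrow> n \<in> W \<Longrightarrow> m + n \<in> W"
    "\<And>r m. 0 \<le> r \<Longrightarrow> m \<in> W \<Longrightarrow> r *\<^sub>R m \<in> W" "\<And>m. m \<in> W \<Longrightarrow> - m \<in> W"
    using W by (auto simp: subspace_def subspace_neg)
  have 1: "sublinear ?Q" and 2: "\<And>x m. m \<in> W \<Longrightarrow> ?Q x \<le> q (x + m) + - f m"
    by (rule sublinear_shift[OF q, of W "\<lambda>m. - f m"]; simp add: W' add scale le)+
  obtain F where F: "linear F" "\<And>x. F x \<le> ?Q x" using linear_below_sublinear[OF 1] by blast
  have Fq: "F x \<le> q x" for x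
    using F(2)[of x] 2[OF W'(1), of x] scale[OF W'(1), of 0] by simp
  have FW: "F x \<le> f x" if "x \<in> W" for x
    using F(2)[of x] 2[OF W'(4)[OF that], of x] neg[OF that] sublinear_zero[OF q] by simp
  have "F x = f x" if "x \<in> W" for x
    using FW[OF that] FW[OF W'(4)[OF that]] neg[OF that] linear_neg[OF F(1)] by simp
  with F(1) Fq that show thesis by blast
qed

text \<open>The scalar action \<open>s\<close> is a parameter because the theorem is applied both to
  the algebra, with \<open>scaleC\<close>, and to the space of its real bounded functionals, with
  \<open>cmul\<close>.\<close>

theorem complex_Hahn_Banach:
  fixes q :: "'v::real_vector \<Rightarrow> real" and s :: "complex \<Rightarrow> 'v \<Rightarrow> 'v" and f :: "'v \<Rightarrow> complex"
  assumes s: "\<And>c x y. s c (x + y) = s c x + s c y" "\<And>c d x. s (c + d) x = s c x + s d x"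
      "\<And>c d x. s c (s d x) = s (c * d) x" "\<And>r x. s (complex_of_real r) x = r *\<^sub>R x"
    and q: "\<And>x y. q (x + y) \<le> q x + q y" "\<And>c x. q (s c x) = cmod c * q x"
    and W: "0 \<in> W" "\<And>x y. x \<in> W \<Longrightarrow> y \<in> W \<Longrightarrow> x + y \<in> W" "\<And>c x. x \<in> W \<Longrightarrow> s c x \<in> W"
    and f: "\<And>x y. x \<in> W \<Longrightarrow> y \<in> W \<Longrightarrow> f (x + y) = f x + f y" "\<And>c x. x \<in> W \<Longrightarrow> f (s c x) = c * f x"
      "\<And>x. x \<in> W \<Longrightarrow> cmod (f x) \<le> q x"
  obtains F where "\<And>x y. F (x + y) = F x + F y" "\<And>c x. F (s c x) = c * F x"
    "\<And>x. cmod (F x) \<le> q x" "\<And>x. x \<in> W \<Longrightarrow> F x = f x"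
proof -
  have sr: "r *\<^sub>R x = s (complex_of_real r) x" for r x by (simp add: s(4))
  have sub: "sublinear q"
  proof (rule sublinearI)
    show "q 0 = 0" using q(2)[of 0 0] s(4)[of 0 0] by simp
  qed (use q in \<open>auto simp: sr\<close>)
  have W': "subspace W" using W by (auto simp: subspace_def sr)
  obtain G where G: "linear G" "\<And>x. G x \<le> q x" "\<And>x. x \<in> W \<Longrightarrow> G x = Re (f x)"
  proof (rule real_Hahn_Banach[OF sub W', of "\<lambda>x. Re (f x)"])
    fix x assume "x \<in> W"
    then show "Re (f x) \<le> q x" using f(3) complex_Re_le_cmod order_trans by blast
  qed (auto simp: f sr)
  define F where "F x = Complex (G x) (- G (s \<i> x))" for x
  have s1: "s 1 x = x" and sm: "s (-1) x = - x" for x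
    using s(4)[of 1 x] s(4)[of "-1" x] by auto
  have Fadd: "F (x + y) = F x + F y" for x y
    by (simp add: F_def s linear_add[OF G(1)] complex_eq_iff)
  have Fs: "F (s c x) = c * F x" for c x
  proof -
    have Gs: "G (s c x) = Re c * G x + Im c * G (s \<i> x)" for c x
    proof -
      have "s c x = Re c *\<^sub>R x + Im c *\<^sub>R s \<i> x"
        by (simp add: sr s(3) flip: s(2)) (metis complex_eq mult.commute)
      then show ?thesis by (simp add: linear_add[OF G(1)] linear_scale[OF G(1)])
    qed
    show ?thesis
      unfolding F_def Gs[of c x] s(3) using Gs[of "\<i> * c" x]
      by (simp add: complex_eq_iff algebra_simps)
  qed
  have FW: "F x = f x" if "x \<in> W" for x
    using G(3)[OF that] G(3)[OF W(3)[OF that, of \<i>]] f(2)[OF that, of \<i>]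
    by (simp add: F_def complex_eq_iff)
  have "cmod (F x) \<le> q x" for x
  proof (cases "F x = 0")
    case True
    have "0 \<le> q x" using sublinear_lower[OF sub, of x] q(2)[of "-1" x] by (simp add: sm)
    with True show ?thesis by simp
  next
    case False
    \<comment> \<open>Rotation by this phase makes the value of \<open>F\<close> real and
      nonnegative, where it coincides with \<open>G\<close>.\<close>
    define c where "c = cnj (F x) / cmod (F x)"
    have c: "cmod c = 1" using False by (simp add: c_def norm_divide)
    have "F (s c x) = complex_of_real (cmod (F x))"
      using False by (simp add: Fs c_def complex_norm_square[symmetric] power2_eq_square
          mult.commute)
    then have "cmod (F x) = G (s c x)" by (simp add: F_def complex_eq_iff)
    also have "\<dots> \<le> q x" using G(2)[of "s c x"] q(2)[of c x] c by simp
    finally show ?thesis .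
  qed
  then show thesis using Fadd Fs FW that by blast
qed


section \<open>Characters of commutative unital Banach algebras\<close>

text \<open>The Neumann series x + x^2 + ... is obtained as the fixed point of a contraction, in a
  form that makes sense in an algebra without unit.\<close>

lemma geometric_quasi_inverse:
  fixes x :: "'a::{real_normed_algebra, banach}"
  assumes "norm x < 1"
  obtains y where "y = x + x * y" "norm y * (1 - norm x) \<le> norm x"
proof -
  have "\<exists>!y. x + x * y = y"
    by (rule banach_fix_type[of "norm x"])
      (use assms in \<open>auto simp: dist_norm norm_mult_ineq simp flip: right_diff_distrib\<close>)
  then obtain y where y: "x + x * y = y" by auto
  moreover have "norm y \<le> norm x + norm x * norm y"
    using norm_triangle_ineq[of x "x * y"] norm_mult_ineq[of x y] y by simp
  ultimately show thesis using that[of y] by (simp add: algebra_simps)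
qed

definition cfunctional :: "('a::complex_banach_algebra \<Rightarrow> complex) \<Rightarrow> bool" where
  "cfunctional f \<longleftrightarrow> (\<forall>x y. f (x + y) = f x + f y) \<and> (\<forall>c x. f (c *\<^sub>C x) = c * f x) \<and>
     (\<exists>C. \<forall>x. cmod (f x) \<le> C * norm x)"

locale unital_commutative =
  fixes e :: "'a::complex_banach_algebra"
  assumes commute: "a * b = b * (a :: 'a)" and unit: "e * a = a"
begin

lemma unit_right [simp]: "a * e = a" and unit_left [simp]: "e * a = a"
  using unit commute by metis+

section \<open>Proper ideals and functionals vanishing on them\<close>

definition alg_ideal :: "'a set \<Rightarrow> bool" where
  "alg_ideal M \<longleftrightarrow> 0 \<in> M \<and> (\<forall>x\<in>M. \<forall>y\<in>M. x + y \<in> M) \<and> (\<forall>a. \<forall>x\<in>M. a * x \<in> M)"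

lemma alg_ideal_scaleC: "alg_ideal M \<Longrightarrow> x \<in> M \<Longrightarrow> c *\<^sub>C x \<in> M"
  unfolding alg_ideal_def by (metis mult_scaleC_left unit)

lemma alg_ideal_diff: "alg_ideal M \<Longrightarrow> x \<in> M \<Longrightarrow> y \<in> M \<Longrightarrow> x - y \<in> M"
  using alg_ideal_scaleC[of M y "-1"] unfolding alg_ideal_def
  by (metis add_uminus_conv_diff complex_vector.scale_minus_left complex_vector.scale_one)

lemma one_minus_inverse:
  assumes "norm x < 1"
  obtains y where "(e - x) * (e + y) = e" "y = x + x * y" "norm y * (1 - norm x) \<le> norm x"
proof -
  obtain y where y: "y = x + x * y" "norm y * (1 - norm x) \<le> norm x"
    using geometric_quasi_inverse[OF assms] .
  have "(e - x) * (e + y) = e + (y - (x + x * y))" by (simp add: algebra_simps)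
  also have "\<dots> = e" using y(1) by simp
  finally show thesis using that y by blast
qed

text \<open>Otherwise rescaling puts some \<open>e - z\<close> with \<open>norm z < 1\<close> into
  \<open>M\<close>, and such an element is invertible. Hence c e + m \<mapsto> c is a functional of
  norm at most 1 on C e + M, and Hahn-Banach applies without passing to the closure of
  \<open>M\<close>.\<close>

lemma proper_ideal_norm:
  assumes M: "alg_ideal M" "e \<notin> M" and m: "m \<in> M"
  shows "cmod c \<le> norm (c *\<^sub>C e + m)"
proof (rule ccontr)
  assume *: "\<not> ?thesis"
  then have c: "c \<noteq> 0" by auto
  define z where "z = (1 / c) *\<^sub>C (c *\<^sub>C e + m)"
  have "norm z < 1" using * c by (simp add: z_def norm_scaleC norm_divide)
  then obtain y where y: "(e - z) * (e + y) = e" using one_minus_inverse by blast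
  have "e - z = (- 1 / c) *\<^sub>C m"
    using c by (simp add: z_def scaleC_add_right scaleC_scaleC complex_vector.scale_minus_left)
  then have "e - z \<in> M" using alg_ideal_scaleC M m by metis
  then have "e \<in> M" using y M(1) commute unfolding alg_ideal_def by metis
  with M show False by simp
qed

lemma ideal_functional:
  assumes M: "alg_ideal M" "e \<notin> M"
  obtains F where "cfunctional F" "\<And>x. cmod (F x) \<le> norm x" "\<And>x. x \<in> M \<Longrightarrow> F x = 0" "F e = 1"
proof -
  let ?W = "{w. \<exists>c. w - c *\<^sub>C e \<in> M}"
  have M': "0 \<in> M" "\<And>x y. x \<in> M \<Longrightarrow> y \<in> M \<Longrightarrow> x + y \<in> M" using M by (auto simp: alg_ideal_def)
  have uniq: "c = d" if "w - c *\<^sub>C e \<in> M" "w - d *\<^sub>C e \<in> M" for w c d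
  proof -
    have "w - d *\<^sub>C e - (w - c *\<^sub>C e) \<in> M" using that alg_ideal_diff M by blast
    from proper_ideal_norm[OF M this, of "d - c"] show ?thesis by (simp add: complex_vector.scale_left_diff_distrib)
  qed
  define f where "f w = (SOME c. w - c *\<^sub>C e \<in> M)" for w
  have f: "f w = c" if "w - c *\<^sub>C e \<in> M" for w c
    unfolding f_def using that uniq by blast
  have mem_add: "x + y - (c + d) *\<^sub>C e \<in> M" if "x - c *\<^sub>C e \<in> M" "y - d *\<^sub>C e \<in> M" for x y c d
    using M'(2)[OF that] by (simp add: scaleC_add_left algebra_simps)
  have mem_scale: "k *\<^sub>C x - (k * c) *\<^sub>C e \<in> M" if "x - c *\<^sub>C e \<in> M" for x k c
    using alg_ideal_scaleC[OF M(1) that, of k] by (simp add: complex_vector.scale_right_diff_distrib scaleC_scaleC)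
  obtain F where F: "\<And>x y. F (x + y) = F x + F y" "\<And>c x. F (c *\<^sub>C x) = c * F x"
    "\<And>x. cmod (F x) \<le> norm x" "\<And>x. x \<in> ?W \<Longrightarrow> F x = f x"
  proof (rule complex_Hahn_Banach[of scaleC norm ?W f])
    show "0 \<in> ?W" using M' by (auto intro: exI[of _ 0])
    show "x + y \<in> ?W" if "x \<in> ?W" "y \<in> ?W" for x y
      using that mem_add by blast
    show "c *\<^sub>C x \<in> ?W" if "x \<in> ?W" for c x
      using that mem_scale by blast
    show "f (x + y) = f x + f y" if "x \<in> ?W" "y \<in> ?W" for x y
      using that mem_add f by fastforce
    show "f (c *\<^sub>C x) = c * f x" if "x \<in> ?W" for c x
      using that mem_scale f by fastforce
    show "cmod (f x) \<le> norm x" if x: "x \<in> ?W" for x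
    proof -
      obtain c where c: "x - c *\<^sub>C e \<in> M" using x by auto
      from proper_ideal_norm[OF M c, of c] f[OF c] show ?thesis by simp
    qed
  qed (auto simp: scaleC_add_left scaleC_add_right scaleC_scaleC scaleR_scaleC norm_scaleC norm_triangle_ineq)
  have "F x = 0" if "x \<in> M" for x
  proof -
    have "x - 0 *\<^sub>C e \<in> M" using that by simp
    then have "x \<in> ?W" "f x = 0" using f[of x 0] by blast+
    then show ?thesis using F(4) by simp
  qed
  moreover have "F e = 1"
  proof -
    have "e - 1 *\<^sub>C e \<in> M" using M'(1) by simp
    then have "e \<in> ?W" "f e = 1" using f[of e 1] by blast+
    then show ?thesis using F(4) by simp
  qed
  moreover have "cfunctional F" using F by (auto simp: cfunctional_def intro!: exI[of _ 1])
  ultimately show thesis using F(3) that by blast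
qed

text \<open>The quotient by \<open>M\<close>, a field by \<open>max\<close>, is never formed. The
  resolvent of \<open>a\<close> modulo \<open>M\<close> is observed through one functional that
  annihilates \<open>M\<close>, which turns it into a scalar function to which Liouville's theorem
  applies.\<close>

lemma Gelfand_Mazur:
  assumes M: "alg_ideal M" "e \<notin> M" and max: "\<And>a. a \<notin> M \<Longrightarrow> \<exists>b. a * b - e \<in> M"
  shows "\<exists>l. a - l *\<^sub>C e \<in> M"
proof (rule ccontr)
  assume "\<not> ?thesis"
  then have "\<forall>l. \<exists>b. (a - l *\<^sub>C e) * b - e \<in> M" using max by blast
  then obtain b where b: "\<And>l. (a - l *\<^sub>C e) * b l - e \<in> M" by metis
  obtain F where F: "cfunctional F" "\<And>x. cmod (F x) \<le> norm x" "\<And>x. x \<in> M \<Longrightarrow> F x = 0" "F e = 1"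
    using ideal_functional[OF M] by blast
  have Fadd: "F (x + y) = F x + F y" and Fscale: "F (c *\<^sub>C x) = c * F x" for x y c
    using F(1) by (auto simp: cfunctional_def)
  have Mmult: "x \<in> M \<Longrightarrow> c * x \<in> M" for x c using M by (auto simp: alg_ideal_def)
  define h where "h l = F (b l)" for l
  \<comment> \<open>Two inverses of the same element modulo \<open>M\<close> agree modulo
    \<open>M\<close>, so \<open>h\<close> does not depend on the choice of \<open>b\<close>.\<close>
  have h: "h l = F x" if x: "(a - l *\<^sub>C e) * x - e \<in> M" for l x
  proof -
    let ?u = "a - l *\<^sub>C e"
    have "b l * (?u * x - e) - x * (?u * b l - e) \<in> M"
      by (intro alg_ideal_diff[OF M(1)] Mmult x b)
    moreover have "b l * (?u * x) = x * (?u * b l)" by (metis commute mult.assoc)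
    ultimately have "x - b l \<in> M" by (simp add: right_diff_distrib)
    then have "F (x - b l) = 0" by (rule F)
    then show ?thesis using Fadd[of "x - b l" "b l"] by (simp add: h_def)
  qed
  have deriv: "(h has_field_derivative F (b m * b m)) (at m)" for m
  proof -
    \<comment> \<open>Expanding the inverse at l around m leaves the error
      \<open>F (b m * b m * y)\<close>, where \<open>y\<close> has norm at most
      \<open>2 * norm x\<close> and \<open>x = (l - m) *\<^sub>C b m\<close>.\<close>
    let ?B = "2 * norm (b m * b m) * norm (b m)"
    have bound: "cmod ((h l - h m) / (l - m) - F (b m * b m)) \<le> ?B * cmod (l - m)"
      if l: "l \<noteq> m" "cmod (l - m) * norm (b m) < 1 / 2" for l
    proof -
      define x where "x = (l - m) *\<^sub>C b m"
      have x: "norm x < 1 / 2" using l by (simp add: x_def norm_scaleC)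
      then have "norm x < 1" by simp
      then obtain y where y: "(e - x) * (e + y) = e" "y = x + x * y" "norm y * (1 - norm x) \<le> norm x"
        using one_minus_inverse by blast
      have "norm y * (1 / 2) \<le> norm y * (1 - norm x)" using x by (intro mult_left_mono) auto
      with y have ny: "norm y \<le> 2 * norm x" by linarith
      have "(a - l *\<^sub>C e) * b m = (a - m *\<^sub>C e) * b m - x"
        by (simp add: x_def complex_vector.scale_left_diff_distrib left_diff_distrib mult_scaleC_left)
      then have "(a - l *\<^sub>C e) * (b m * (e + y)) - e = ((a - m *\<^sub>C e) * b m - x) * (e + y) - (e - x) * (e + y)"
        using y(1) by (simp only: mult.assoc[symmetric])
      also have "\<dots> = ((a - m *\<^sub>C e) * b m - e) * (e + y)"
        unfolding left_diff_distrib[symmetric] by simp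
      also have "\<dots> = (e + y) * ((a - m *\<^sub>C e) * b m - e)" by (rule commute)
      finally have "(a - l *\<^sub>C e) * (b m * (e + y)) - e \<in> M" using Mmult b by metis
      then have "h l = F (b m * (e + y))" by (rule h)
      also have "b m * (e + y) = b m + (l - m) *\<^sub>C (b m * b m) + (l - m) *\<^sub>C (b m * b m * y)"
        by (subst y(2)) (simp add: x_def distrib_left mult_scaleC_left mult_scaleC_right mult.assoc)
      finally have "(h l - h m) / (l - m) - F (b m * b m) = F (b m * b m * y)"
        using l by (simp only: Fadd Fscale h_def[of m]) (simp add: field_simps)
      also have "cmod \<dots> \<le> norm (b m * b m) * norm y"
        using F(2) norm_mult_ineq order_trans by blast
      also have "\<dots> \<le> norm (b m * b m) * (2 * norm x)" using ny by (intro mult_left_mono) auto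
      finally show ?thesis by (simp add: x_def norm_scaleC mult_ac)
    qed
    have "((\<lambda>l. cmod (l - m) * norm (b m)) \<longlongrightarrow> cmod (m - m) * norm (b m)) (at m)"
      by (intro tendsto_intros)
    then have "\<forall>\<^sub>F l in at m. cmod (l - m) * norm (b m) < 1 / 2"
      by (rule order_tendstoD) auto
    then have ev: "\<forall>\<^sub>F l in at m. norm ((h l - h m) / (l - m) - F (b m * b m)) \<le> ?B * cmod (l - m)"
      using eventually_neq_at_within[of m m UNIV] by eventually_elim (use bound in auto)
    have "((\<lambda>l. ?B * cmod (l - m)) \<longlongrightarrow> ?B * cmod (m - m)) (at m)"
      by (intro tendsto_intros)
    then have "((\<lambda>l. (h l - h m) / (l - m) - F (b m * b m)) \<longlongrightarrow> 0) (at m)"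
      using Lim_null_comparison[OF ev] by simp
    then show ?thesis by (simp add: has_field_derivative_iff LIM_zero_iff)
  qed
  have large: "\<exists>y. h l = - (1 / l) * F (e + y) \<and> norm y < 1" if l: "cmod l > 2 * norm a" for l
  proof -
    have l0: "l \<noteq> 0" using l by auto
    define x where "x = (1 / l) *\<^sub>C a"
    have x: "norm x < 1 / 2" using l l0 by (simp add: x_def norm_scaleC norm_divide field_simps)
    then have "norm x < 1" by simp
    then obtain y where y: "(e - x) * (e + y) = e" "norm y * (1 - norm x) \<le> norm x"
      using one_minus_inverse by metis
    have "norm y * (1 / 2) \<le> norm y * (1 - norm x)" using x by (intro mult_left_mono) auto
    with y x have ny: "norm y < 1" by linarith
    have "a - l *\<^sub>C e = (- l) *\<^sub>C (e - x)"
      using l0 by (simp add: x_def complex_vector.scale_right_diff_distrib scaleC_scaleC complex_vector.scale_minus_left)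
    then have "(a - l *\<^sub>C e) * ((- (1 / l)) *\<^sub>C (e + y)) = e"
      using y(1) l0 by (simp only: mult_scaleC_left mult_scaleC_right scaleC_scaleC) simp
    then have "h l = F ((- (1 / l)) *\<^sub>C (e + y))"
      using M(1) by (intro h) (simp add: alg_ideal_def)
    then have "h l = - (1 / l) * F (e + y)" by (simp only: Fscale)
    with ny show ?thesis by blast
  qed
  have "(h \<longlongrightarrow> 0) at_infinity"
  proof (rule Lim_null_comparison)
    show "\<forall>\<^sub>F l in at_infinity. norm (h l) \<le> (norm e + 1) * norm (inverse l)"
      unfolding eventually_at_infinity
    proof (intro exI allI impI)
      fix l :: complex assume "2 * norm a + 1 \<le> norm l"
      then obtain y where y: "h l = - (1 / l) * F (e + y)" "norm y < 1" using large[of l] by auto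
      have "cmod (F (e + y)) \<le> norm e + 1"
        using F(2)[of "e + y"] norm_triangle_ineq[of e y] y(2) by linarith
      then have "cmod (F (e + y)) * norm (inverse l) \<le> (norm e + 1) * norm (inverse l)"
        by (intro mult_right_mono) auto
      then show "norm (h l) \<le> (norm e + 1) * norm (inverse l)"
        using y(1) by (simp add: norm_mult norm_divide norm_inverse divide_inverse mult.commute)
    qed
    show "((\<lambda>l::complex. (norm e + 1) * norm (inverse l)) \<longlongrightarrow> 0) at_infinity"
      using tendsto_mult[OF tendsto_const tendsto_norm_zero[OF tendsto_inverse_0], of "norm e + 1"]
      by simp
  qed
  moreover have "h holomorphic_on UNIV"
    using deriv by (auto simp: holomorphic_on_def field_differentiable_def)
  ultimately have h0: "h l = 0" for l using Liouville_weak_0 by blast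
  \<comment> \<open>Any point beyond \<open>2 * norm a\<close> gives the contradiction: there
    \<open>h l = 0\<close> forces \<open>F y = -1\<close> although
    \<open>norm y < 1\<close>.\<close>
  let ?l = "complex_of_real (2 * norm a + 1)"
  have "norm ?l > 2 * norm a" unfolding norm_of_real by simp
  then obtain y where y: "h ?l = - (1 / ?l) * F (e + y)" "norm y < 1" using large by blast
  have "?l \<noteq> 0" using norm_ge_zero[of a] by (simp only: of_real_eq_0_iff)
  then have "F (e + y) = 0" using y(1) h0[of ?l] by simp
  then have "F y = -1" using Fadd[of e y] F(4) by (simp add: eq_neg_iff_add_eq_0 add.commute)
  then show False using F(2)[of y] y(2) by simp
qed

section \<open>Characters from maximal ideals\<close>

definition character :: "('a \<Rightarrow> complex) \<Rightarrow> bool" where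
  "character \<phi> \<longleftrightarrow> cfunctional \<phi> \<and> (\<forall>x y. \<phi> (x * y) = \<phi> x * \<phi> y) \<and> \<phi> e = 1"

text \<open>By Gelfand-Mazur each x is congruent to a multiple of \<open>e\<close> modulo
  \<open>M\<close>, and applying \<open>F\<close> identifies the coefficient as \<open>F x\<close>.
  Multiplicativity follows because \<open>M\<close> is an ideal.\<close>

lemma character_of_maximal_ideal:
  assumes M: "alg_ideal M" "e \<notin> M" and max: "\<And>a. a \<notin> M \<Longrightarrow> \<exists>b. a * b - e \<in> M"
  obtains \<phi> where "character \<phi>" "\<And>x. x \<in> M \<Longrightarrow> \<phi> x = 0"
proof -
  obtain F where F: "cfunctional F" "\<And>x. x \<in> M \<Longrightarrow> F x = 0" "F e = 1"
    using ideal_functional[OF M] by metis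
  have Fadd: "F (x + y) = F x + F y" and Fscale: "F (c *\<^sub>C x) = c * F x" for x y c
    using F(1) by (auto simp: cfunctional_def)
  have diff: "x - F x *\<^sub>C e \<in> M" for x
  proof -
    obtain l where l: "x - l *\<^sub>C e \<in> M" using Gelfand_Mazur[OF M max] by blast
    have "F x = l"
      using Fadd[of "x - l *\<^sub>C e" "l *\<^sub>C e"] F(2)[OF l] F(3) by (simp add: Fscale)
    with l show ?thesis by simp
  qed
  have "F (x * y) = F x * F y" for x y
  proof -
    have "y * (x - F x *\<^sub>C e) \<in> M" using diff M(1) by (auto simp: alg_ideal_def)
    from F(2)[OF this] have "F (x * y - F x *\<^sub>C y) = 0"
      by (simp add: right_diff_distrib mult_scaleC_right commute[of y])
    then show ?thesis using Fadd[of "x * y - F x *\<^sub>C y" "F x *\<^sub>C y"] by (simp add: Fscale)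
  qed
  then show thesis using that F by (auto simp: character_def)
qed

lemma character_vanishing_on_ideal:
  assumes J: "alg_ideal J" "e \<notin> J"
  obtains \<phi> where "character \<phi>" "\<And>x. x \<in> J \<Longrightarrow> \<phi> x = 0"
proof -
  let ?A = "{M. alg_ideal M \<and> e \<notin> M \<and> J \<subseteq> M}"
  have "\<exists>M\<in>?A. \<forall>X\<in>?A. M \<subseteq> X \<longrightarrow> X = M"
  proof (rule subset_Zorn_nonempty)
    show "?A \<noteq> {}" using J by auto
    fix C assume C: "C \<noteq> {}" "subset.chain ?A C"
    then have sub: "C \<subseteq> ?A" and tot: "X \<in> C \<Longrightarrow> Y \<in> C \<Longrightarrow> X \<subseteq> Y \<or> Y \<subseteq> X" for X Y
      by (auto simp: subset_chain_def)
    have "x + y \<in> \<Union>C" if xy: "x \<in> \<Union>C" "y \<in> \<Union>C" for x y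
    proof -
      obtain X Y where "X \<in> C" "x \<in> X" "Y \<in> C" "y \<in> Y" using xy by auto
      then obtain Z where Z: "Z \<in> C" "x \<in> Z" "y \<in> Z" using tot by blast
      then have "x + y \<in> Z" using sub by (auto simp: alg_ideal_def)
      with Z show ?thesis by blast
    qed
    moreover have "a * x \<in> \<Union>C" if "x \<in> \<Union>C" for a x
      using that sub unfolding alg_ideal_def by blast
    moreover have "0 \<in> \<Union>C"
      using sub C(1) unfolding alg_ideal_def by blast
    moreover have "e \<notin> \<Union>C" "J \<subseteq> \<Union>C"
      using sub C(1) by blast+
    ultimately show "\<Union>C \<in> ?A" by (auto simp: alg_ideal_def)
  qed
  then obtain M where M: "alg_ideal M" "e \<notin> M" "J \<subseteq> M"
    and max: "\<forall>X\<in>?A. M \<subseteq> X \<longrightarrow> X = M"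
    by auto
  have "\<exists>b. a * b - e \<in> M" if a: "a \<notin> M" for a
  proof -
    \<comment> \<open>This is the ideal generated by \<open>M\<close> and \<open>a\<close>. It
      contains \<open>e\<close> by maximality.\<close>
    let ?X = "{x. \<exists>b. a * b - x \<in> M}"
    have 0: "0 \<in> M" "\<And>x y. x \<in> M \<Longrightarrow> y \<in> M \<Longrightarrow> x + y \<in> M" "\<And>c x. x \<in> M \<Longrightarrow> c * x \<in> M"
      using M(1) by (auto simp: alg_ideal_def)
    have "alg_ideal ?X"
      unfolding alg_ideal_def
    proof (intro conjI ballI allI)
      show "0 \<in> ?X" using 0(1) by (auto intro: exI[of _ 0])
      show "x + y \<in> ?X" if "x \<in> ?X" "y \<in> ?X" for x y
      proof -
        from \<open>x \<in> ?X\<close> \<open>y \<in> ?X\<close> obtain b c where "a * b - x \<in> M" "a * c - y \<in> M" by blast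
        from 0(2)[OF this] have "a * (b + c) - (x + y) \<in> M" by (simp add: algebra_simps)
        then show ?thesis by blast
      qed
      show "c * x \<in> ?X" if "x \<in> ?X" for c x
      proof -
        from that obtain b where "a * b - x \<in> M" by blast
        from 0(3)[OF this, of c] have "a * (c * b) - c * x \<in> M"
          by (simp add: right_diff_distrib mult.assoc[symmetric] commute[of c a])
        then show ?thesis by blast
      qed
    qed
    moreover have "M \<subseteq> ?X"
      using alg_ideal_diff[OF M(1) 0(1)] by (auto intro!: exI[of _ 0])
    moreover have "a \<in> ?X" using 0(1) by (auto intro!: exI[of _ e])
    ultimately have "e \<in> ?X" using max M(3) a by blast
    then show ?thesis by blast
  qed
  then obtain \<phi> where "character \<phi>" "\<And>x. x \<in> M \<Longrightarrow> \<phi> x = 0"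
    using character_of_maximal_ideal[OF M(1,2)] by blast
  then show thesis using that M(3) by blast
qed

lemma finite_dimensional_criterion:
  assumes q: "\<And>\<phi>. character \<phi> \<Longrightarrow> \<exists>q. \<phi> q = 1 \<and> (\<forall>a. a * q = \<phi> a *\<^sub>C q)"
  shows "complex_finite_dimensional TYPE('a)"
proof -
  \<comment> \<open>These are the joint eigenvectors of all multiplications. Every subset of
    \<open>T\<close> spans an ideal, so a finite subset whose span contains \<open>e\<close> spans
    the whole algebra.\<close>
  define T where "T = {q :: 'a. \<forall>a. \<exists>c. a * q = c *\<^sub>C q}"
  have T: "a * x \<in> complex_vector.span S" if "x \<in> complex_vector.span S" "S \<subseteq> T" for a x S
    using that(1)
  proof (induction rule: complex_vector.span_induct_alt)
    case (step c q y)
    then obtain d where "a * q = d *\<^sub>C q" using \<open>S \<subseteq> T\<close> unfolding T_def by blast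
    then have "a * (c *\<^sub>C q + y) = (c * d) *\<^sub>C q + a * y"
      by (simp add: distrib_left mult_scaleC_right scaleC_scaleC)
    with step show ?case
      by (simp add: complex_vector.span_add complex_vector.span_scale complex_vector.span_base)
  qed (simp add: complex_vector.span_zero)
  have ideal: "alg_ideal (complex_vector.span T)"
    using T by (auto simp: alg_ideal_def complex_vector.span_zero complex_vector.span_add)
  have "e \<in> complex_vector.span T"
  proof (rule ccontr)
    assume "e \<notin> complex_vector.span T"
    then obtain \<phi> where \<phi>: "character \<phi>" "\<And>x. x \<in> complex_vector.span T \<Longrightarrow> \<phi> x = 0"
      using character_vanishing_on_ideal[OF ideal] by blast
    obtain q where "\<phi> q = 1" "\<And>a. a * q = \<phi> a *\<^sub>C q" using q[OF \<phi>(1)] by blast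
    moreover from this have "q \<in> complex_vector.span T"
      by (intro complex_vector.span_base) (auto simp: T_def)
    ultimately show False using \<phi>(2)[of q] by simp
  qed
  then obtain S where S: "finite S" "S \<subseteq> T" "e \<in> complex_vector.span S"
    unfolding complex_vector.span_explicit by blast
  then have "complex_vector.span S = UNIV"
    using T[OF S(3,2)] by auto
  then show ?thesis unfolding complex_finite_dimensional_def using S(1) by blast
qed

end


section \<open>Approximately inner derivations into dual modules\<close>

abbreviation dual_elt :: "('x, 'm) cspace_scheme \<Rightarrow> ('x \<Rightarrow> complex) set" where
  "dual_elt X \<equiv> vcarrier (dual_cspace X)"

lemma dual_bimod_sel [simp]:
  "vcarrier (dual_bimod X) = dual_elt X" "vadd (dual_bimod X) = (\<lambda>f g x. f x + g x)"
  "vzero (dual_bimod X) = (\<lambda>x. 0)" "vscale (dual_bimod X) = (\<lambda>c f x. c * f x)"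
  "vnorm (dual_bimod X) = (\<lambda>f. SUP x\<in>vcarrier X. cmod (f x) / vnorm X x)"
  "lact (dual_bimod X) = (\<lambda>a f x. if x \<in> vcarrier X then f (ract X x a) else 0)"
  "ract (dual_bimod X) = (\<lambda>f a x. if x \<in> vcarrier X then f (lact X a x) else 0)"
  by (simp_all add: dual_bimod_def cspace.defs bimod.defs dual_cspace_def)

lemma dual_eltI:
  assumes "\<And>x y. x \<in> vcarrier X \<Longrightarrow> y \<in> vcarrier X \<Longrightarrow> f (vadd X x y) = f x + f y"
    "\<And>c x. x \<in> vcarrier X \<Longrightarrow> f (vscale X c x) = c * f x"
    "\<And>x. x \<in> vcarrier X \<Longrightarrow> cmod (f x) \<le> C * vnorm X x" "\<And>x. x \<notin> vcarrier X \<Longrightarrow> f x = 0"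
  shows "f \<in> dual_elt X"
  using assms unfolding dual_cspace_def by (auto intro!: exI[of _ C])

lemma dual_eltD:
  assumes "f \<in> dual_elt X"
  shows "\<And>x y. x \<in> vcarrier X \<Longrightarrow> y \<in> vcarrier X \<Longrightarrow> f (vadd X x y) = f x + f y"
    "\<And>c x. x \<in> vcarrier X \<Longrightarrow> f (vscale X c x) = c * f x"
    "\<And>x. x \<notin> vcarrier X \<Longrightarrow> f x = 0"
  using assms unfolding dual_cspace_def by auto

context complex_normed_space
begin

lemma dual_elt_bounded:
  assumes "f \<in> dual_elt X"
  obtains C where "0 \<le> C" "\<And>x. x \<in> vcarrier X \<Longrightarrow> cmod (f x) \<le> C * vnorm X x"
proof -
  have "\<exists>C. \<forall>x\<in>vcarrier X. cmod (f x) \<le> C * vnorm X x"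
    using assms by (simp add: dual_cspace_def)
  then obtain C where C: "\<And>x. x \<in> vcarrier X \<Longrightarrow> cmod (f x) \<le> C * vnorm X x" by blast
  have "cmod (f x) \<le> \<bar>C\<bar> * vnorm X x" if "x \<in> vcarrier X" for x
    using C[OF that] norm_nonneg[OF that] by (smt (verit) mult_right_mono abs_ge_self)
  then show thesis using that[of "\<bar>C\<bar>"] by simp
qed

lemma dual_norm_bound:
  assumes "f \<in> dual_elt X" "x \<in> vcarrier X"
  shows "cmod (f x) \<le> (SUP x\<in>vcarrier X. cmod (f x) / vnorm X x) * vnorm X x"
proof -
  obtain C where C: "0 \<le> C" "\<And>x. x \<in> vcarrier X \<Longrightarrow> cmod (f x) \<le> C * vnorm X x"
    using dual_elt_bounded[OF assms(1)] by blast
  show ?thesis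
  proof (cases "vnorm X x = 0")
    case False
    then have pos: "vnorm X x > 0" using norm_nonneg[OF assms(2)] by simp
    have "bdd_above ((\<lambda>x. cmod (f x) / vnorm X x) ` vcarrier X)"
    proof (rule bdd_aboveI2)
      fix x assume "x \<in> vcarrier X"
      then show "cmod (f x) / vnorm X x \<le> C"
        using C norm_nonneg[of x] by (cases "vnorm X x = 0") (auto simp: divide_simps)
    qed
    then have "cmod (f x) / vnorm X x \<le> (SUP x\<in>vcarrier X. cmod (f x) / vnorm X x)"
      using assms(2) by (rule cSUP_upper2) simp
    then show ?thesis using pos by (simp add: divide_simps)
  qed (use C(2)[OF assms(2)] in auto)
qed

lemma dual_norm_least:
  assumes "0 \<le> C" "\<And>x. x \<in> vcarrier X \<Longrightarrow> cmod (f x) \<le> C * vnorm X x"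
  shows "(SUP x\<in>vcarrier X. cmod (f x) / vnorm X x) \<le> C"
proof (rule cSUP_least)
  fix x assume "x \<in> vcarrier X"
  then show "cmod (f x) / vnorm X x \<le> C"
    using assms norm_nonneg[of x] by (cases "vnorm X x = 0") (auto simp: divide_simps)
qed (use zero_closed in auto)

lemma dual_norm_nonneg:
  assumes "f \<in> dual_elt X"
  shows "0 \<le> (SUP x\<in>vcarrier X. cmod (f x) / vnorm X x)"
proof (rule ccontr)
  let ?N = "SUP x\<in>vcarrier X. cmod (f x) / vnorm X x"
  assume neg: "\<not> 0 \<le> ?N"
  have "f x = 0" if "x \<in> vcarrier X" for x
  proof -
    have "?N * vnorm X x \<le> 0" using neg norm_nonneg[OF that] by (simp add: mult_nonpos_nonneg)
    with dual_norm_bound[OF assms that] have "cmod (f x) \<le> 0" by (rule order_trans)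
    then show ?thesis by simp
  qed
  then have "?N = (SUP x\<in>vcarrier X. 0)" by (intro SUP_cong) auto
  also have "\<dots> = 0" using zero_closed by (intro cSUP_const) auto
  finally show False using neg by simp
qed

lemma dual_elt_lincomb:
  assumes "f \<in> dual_elt X" "g \<in> dual_elt X"
  shows "(\<lambda>x. f x + c * g x) \<in> dual_elt X"
proof -
  obtain C where C: "0 \<le> C" "\<And>x. x \<in> vcarrier X \<Longrightarrow> cmod (f x) \<le> C * vnorm X x"
    using dual_elt_bounded[OF assms(1)] by blast
  obtain D where D: "0 \<le> D" "\<And>x. x \<in> vcarrier X \<Longrightarrow> cmod (g x) \<le> D * vnorm X x"
    using dual_elt_bounded[OF assms(2)] by blast
  show ?thesis
  proof (rule dual_eltI[where C = "C + cmod c * D"])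
    fix x assume x: "x \<in> vcarrier X"
    have "cmod (f x + c * g x) \<le> cmod (f x) + cmod c * cmod (g x)"
      using norm_triangle_ineq[of "f x" "c * g x"] by (simp add: norm_mult)
    also have "\<dots> \<le> C * vnorm X x + cmod c * (D * vnorm X x)"
      using C(2) D(2) x by (intro add_mono mult_left_mono) auto
    finally show "cmod (f x + c * g x) \<le> (C + cmod c * D) * vnorm X x" by (simp add: algebra_simps)
  qed (auto simp: dual_eltD[OF assms(1)] dual_eltD[OF assms(2)] algebra_simps)
qed

lemma dual_elt_zero: "(\<lambda>x. 0) \<in> dual_elt X"
  by (rule dual_eltI[where C = 0]) auto

end

lemma complex_normed_space_dual:
  fixes X :: "('a::complex_banach_algebra, 'x) bimod"
  assumes "complex_normed_space X"
  shows "complex_normed_space (dual_bimod X)"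
proof -
  interpret complex_normed_space X by fact
  have scale: "(\<lambda>x. c * f x) \<in> dual_elt X" if "f \<in> dual_elt X" for c f
    using dual_elt_lincomb[OF dual_elt_zero that, of c] by simp
  have add: "(\<lambda>x. f x + g x) \<in> dual_elt X" if "f \<in> dual_elt X" "g \<in> dual_elt X" for f g
    using dual_elt_lincomb[OF that, of 1] by simp
  have [simp]: "vcarrier X \<noteq> {}" using zero_closed by auto
  let ?N = "\<lambda>f. SUP x\<in>vcarrier X. cmod (f x) / vnorm X x"
  have N_scale_le: "?N (\<lambda>x. c * f x) \<le> cmod c * ?N f" if "f \<in> dual_elt X" for c f
    using dual_norm_bound[OF that] dual_norm_nonneg[OF that]
    by (intro dual_norm_least) (auto simp: norm_mult mult_left_mono mult.assoc)
  show ?thesis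
  proof
    fix f assume f: "f \<in> vcarrier (dual_bimod X)"
    show "(vnorm (dual_bimod X) f = 0) = (f = vzero (dual_bimod X))"
    proof
      assume "vnorm (dual_bimod X) f = 0"
      then have "f x = 0" for x
        using dual_norm_bound[of f x] dual_eltD(3)[of f X x] f by (cases "x \<in> vcarrier X") auto
      then show "f = vzero (dual_bimod X)" by auto
    next
      assume "f = vzero (dual_bimod X)"
      then show "vnorm (dual_bimod X) f = 0" by simp
    qed
    show "vnorm (dual_bimod X) (vscale (dual_bimod X) c f) = cmod c * vnorm (dual_bimod X) f" for c
    proof (cases "c = 0")
      case True
      then show ?thesis using zero_closed by auto
    next
      case False
      have "?N (\<lambda>x. (1 / c) * (c * f x)) \<le> cmod (1 / c) * ?N (\<lambda>x. c * f x)"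
        using f by (intro N_scale_le scale) auto
      then have "?N f \<le> ?N (\<lambda>x. c * f x) / cmod c" using False by (simp add: norm_divide)
      then have "cmod c * ?N f \<le> ?N (\<lambda>x. c * f x)" using False by (simp add: field_simps)
      with N_scale_le[of f c] f show ?thesis by (simp add: norm_mult)
    qed
    fix g assume g: "g \<in> vcarrier (dual_bimod X)"
    have "?N (\<lambda>x. f x + g x) \<le> ?N f + ?N g"
    proof (rule dual_norm_least)
      fix x assume x: "x \<in> vcarrier X"
      show "cmod (f x + g x) \<le> (?N f + ?N g) * vnorm X x"
        using norm_triangle_ineq[of "f x" "g x"] dual_norm_bound[of f x] dual_norm_bound[of g x] f g x
        by (simp add: distrib_right)
    qed (use dual_norm_nonneg f g in auto)
    then show "vnorm (dual_bimod X) (vadd (dual_bimod X) f g) \<le> vnorm (dual_bimod X) f + vnorm (dual_bimod X) g"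
      by simp
  qed (use add scale dual_norm_nonneg dual_elt_zero in \<open>auto simp: algebra_simps\<close>)
qed

section \<open>Derivations into dual bimodules\<close>

lemma (in banach_bimodule) action_bounds:
  obtains C where "0 \<le> C" "\<And>a x. x \<in> vcarrier X \<Longrightarrow> vnorm X (lact X a x) \<le> C * norm a * vnorm X x"
    "\<And>a x. x \<in> vcarrier X \<Longrightarrow> vnorm X (ract X x a) \<le> C * norm a * vnorm X x"
proof -
  obtain C1 where C1: "\<And>a x. x \<in> vcarrier X \<Longrightarrow> vnorm X (lact X a x) \<le> C1 * norm a * vnorm X x"
    using lact_bounded by blast
  obtain C2 where C2: "\<And>a x. x \<in> vcarrier X \<Longrightarrow> vnorm X (ract X x a) \<le> C2 * norm a * vnorm X x"
    using ract_bounded by blast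
  let ?C = "max 0 (max C1 C2)"
  have "C1 * norm a * vnorm X x \<le> ?C * norm a * vnorm X x"
    "C2 * norm a * vnorm X x \<le> ?C * norm a * vnorm X x" if "x \<in> vcarrier X" for a x
    using norm_nonneg[OF that] by (intro mult_right_mono; simp)+
  with C1 C2 that[of ?C] show thesis by (meson max.cobounded1 order_trans)
qed

lemma (in banach_bimodule) inner_derivation_dual:
  "inner_derivation (dual_bimod X) \<xi> a x =
     (if x \<in> vcarrier X then \<xi> (ract X x a) - \<xi> (lact X a x) else 0)"
  by (simp add: inner_derivation_def vsub_def)

lemma (in banach_bimodule) inner_derivation_dual_bound:
  assumes \<xi>: "\<xi> \<in> dual_elt X"
  obtains C where "0 \<le> C"
    "\<And>a x. x \<in> vcarrier X \<Longrightarrow> cmod (\<xi> (ract X x a) - \<xi> (lact X a x)) \<le> C * norm a * vnorm X x"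
proof -
  obtain B where B: "0 \<le> B" "\<And>a x. x \<in> vcarrier X \<Longrightarrow> vnorm X (lact X a x) \<le> B * norm a * vnorm X x"
    "\<And>a x. x \<in> vcarrier X \<Longrightarrow> vnorm X (ract X x a) \<le> B * norm a * vnorm X x"
    using action_bounds by blast
  obtain C where C: "0 \<le> C" "\<And>x. x \<in> vcarrier X \<Longrightarrow> cmod (\<xi> x) \<le> C * vnorm X x"
    using dual_elt_bounded[OF \<xi>] by blast
  have "cmod (\<xi> (ract X x a) - \<xi> (lact X a x)) \<le> (2 * (C * B)) * norm a * vnorm X x"
    if x: "x \<in> vcarrier X" for a x
  proof -
    have "cmod (\<xi> (ract X x a)) \<le> C * (B * norm a * vnorm X x)"
      using C(2)[OF ract_closed[OF x]] mult_left_mono[OF B(3)[OF x] C(1)] by (rule order_trans)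
    moreover have "cmod (\<xi> (lact X a x)) \<le> C * (B * norm a * vnorm X x)"
      using C(2)[OF lact_closed[OF x]] mult_left_mono[OF B(2)[OF x] C(1)] by (rule order_trans)
    ultimately show ?thesis
      using norm_triangle_ineq4[of "\<xi> (ract X x a)" "\<xi> (lact X a x)"] by (simp add: algebra_simps)
  qed
  then show thesis using that B(1) C(1) by (meson mult_nonneg_nonneg zero_le_numeral)
qed

lemma (in banach_bimodule) inner_derivation_dual_closed:
  assumes \<xi>: "\<xi> \<in> dual_elt X"
  shows "inner_derivation (dual_bimod X) \<xi> a \<in> dual_elt X"
proof -
  obtain C where C: "\<And>a x. x \<in> vcarrier X \<Longrightarrow> cmod (\<xi> (ract X x a) - \<xi> (lact X a x)) \<le> C * norm a * vnorm X x"
    using inner_derivation_dual_bound[OF \<xi>] by metis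
  show ?thesis
    by (rule dual_eltI[where C = "C * norm a"])
      (use C in \<open>auto simp: inner_derivation_dual add_closed scale_closed ract_closed lact_closed
        ract_add_left lact_add_right ract_scale_left lact_scale_right dual_eltD[OF \<xi>] algebra_simps\<close>)
qed

text \<open>The form in which the filter is used: one functional for each finite set and tolerance,
  with a constant \<open>K\<close> common to all of them, and with norms unfolded into values at
  vectors.\<close>

lemma (in banach_bimodule) boundedly_approximately_innerD:
  assumes bai: "boundedly_approximately_inner (dual_bimod X) D"
  obtains K where "0 \<le> K"
    "\<And>S \<epsilon>. finite S \<Longrightarrow> 0 < \<epsilon> \<Longrightarrow> \<exists>\<xi>\<in>dual_elt X.
       (\<forall>a. \<forall>x\<in>vcarrier X. cmod (\<xi> (ract X x a) - \<xi> (lact X a x)) \<le> K * norm a * vnorm X x) \<and>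
       (\<forall>a\<in>S. \<forall>x\<in>vcarrier X. cmod (\<xi> (ract X x a) - \<xi> (lact X a x) - D a x) \<le> \<epsilon> * vnorm X x)"
proof -
  interpret Y: complex_normed_space "dual_bimod X"
    by (rule complex_normed_space_dual) unfold_locales
  interpret YM: Metric_space "dual_elt X" "vdist (dual_bimod X)"
    using Y.Metric_space_vdist by simp
  obtain F C where F: "F \<noteq> bot" "\<forall>\<^sub>F \<xi> in F. \<xi> \<in> dual_elt X"
    and C: "\<forall>\<^sub>F \<xi> in F. op_norm (dual_bimod X) (inner_derivation (dual_bimod X) \<xi>) \<le> C"
    and lim: "\<And>a. limitin YM.mtopology (\<lambda>\<xi>. inner_derivation (dual_bimod X) \<xi> a) (D a) F"
    using bai unfolding boundedly_approximately_inner_def vtopology_def by auto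
  have Dd: "D a \<in> dual_elt X" for a using lim[of a] by (auto simp: YM.limitin_metric)
  have bound: "cmod (\<xi> (ract X x a) - \<xi> (lact X a x)) \<le> max 0 C * norm a * vnorm X x"
    if \<xi>: "\<xi> \<in> dual_elt X" and op: "op_norm (dual_bimod X) (inner_derivation (dual_bimod X) \<xi>) \<le> C"
      and x: "x \<in> vcarrier X" for \<xi> a x
  proof (cases "a = 0")
    case True
    then show ?thesis
      using inner_derivation_dual_bound[OF \<xi>] x by (metis mult_zero_left mult_zero_right norm_zero)
  next
    case False
    let ?T = "inner_derivation (dual_bimod X) \<xi>"
    obtain B where B: "0 \<le> B" "\<And>a x. x \<in> vcarrier X \<Longrightarrow> cmod (\<xi> (ract X x a) - \<xi> (lact X a x)) \<le> B * norm a * vnorm X x"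
      using inner_derivation_dual_bound[OF \<xi>] by metis
    have TB: "vnorm (dual_bimod X) (?T a) \<le> B * norm a" for a
      unfolding dual_bimod_sel by (rule dual_norm_least) (use B in \<open>auto simp: inner_derivation_dual\<close>)
    \<comment> \<open>A real supremum dominates its members only over a set bounded above. The crude
      bound \<open>B\<close>, which depends on \<xi>, is there to guarantee this.\<close>
    have "bdd_above (range (\<lambda>a. vnorm (dual_bimod X) (?T a) / norm a))"
    proof (rule bdd_aboveI2)
      fix a show "vnorm (dual_bimod X) (?T a) / norm a \<le> B"
        using TB[of a] B(1) by (cases "a = 0") (auto simp: divide_simps)
    qed
    then have "vnorm (dual_bimod X) (?T a) / norm a \<le> op_norm (dual_bimod X) ?T"
      unfolding op_norm_def by (rule cSUP_upper[OF UNIV_I])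
    with op have "vnorm (dual_bimod X) (?T a) / norm a \<le> max 0 C" by linarith
    then have T: "vnorm (dual_bimod X) (?T a) \<le> max 0 C * norm a" using False by (simp add: divide_simps)
    have "cmod (?T a x) \<le> vnorm (dual_bimod X) (?T a) * vnorm X x"
      unfolding dual_bimod_sel by (rule dual_norm_bound[OF inner_derivation_dual_closed[OF \<xi>] x])
    also have "\<dots> \<le> max 0 C * norm a * vnorm X x"
      using T norm_nonneg[OF x] by (rule mult_right_mono)
    finally show ?thesis using x by (simp add: inner_derivation_dual)
  qed
  show thesis
  proof (rule that[of "max 0 C"])
    fix S :: "'a set" and \<epsilon> :: real assume S: "finite S" "0 < \<epsilon>"
    have "\<forall>\<^sub>F \<xi> in F. vdist (dual_bimod X) (inner_derivation (dual_bimod X) \<xi> a) (D a) < \<epsilon>" for a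
      using lim[of a] S(2) by (auto simp: YM.limitin_metric elim!: eventually_mono)
    then have "\<forall>\<^sub>F \<xi> in F. \<forall>a\<in>S. vdist (dual_bimod X) (inner_derivation (dual_bimod X) \<xi> a) (D a) < \<epsilon>"
      using S(1) by (simp add: eventually_ball_finite)
    with F(2) C have "\<forall>\<^sub>F \<xi> in F. \<xi> \<in> dual_elt X \<and>
        op_norm (dual_bimod X) (inner_derivation (dual_bimod X) \<xi>) \<le> C \<and>
        (\<forall>a\<in>S. vdist (dual_bimod X) (inner_derivation (dual_bimod X) \<xi> a) (D a) < \<epsilon>)"
      by eventually_elim auto
    then obtain \<xi> where \<xi>: "\<xi> \<in> dual_elt X"
        "op_norm (dual_bimod X) (inner_derivation (dual_bimod X) \<xi>) \<le> C"
        "\<And>a. a \<in> S \<Longrightarrow> vdist (dual_bimod X) (inner_derivation (dual_bimod X) \<xi> a) (D a) < \<epsilon>"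
      using eventually_happens'[OF F(1)] by (smt (verit, best))
    show "\<exists>\<xi>\<in>dual_elt X.
       (\<forall>a. \<forall>x\<in>vcarrier X. cmod (\<xi> (ract X x a) - \<xi> (lact X a x)) \<le> max 0 C * norm a * vnorm X x) \<and>
       (\<forall>a\<in>S. \<forall>x\<in>vcarrier X. cmod (\<xi> (ract X x a) - \<xi> (lact X a x) - D a x) \<le> \<epsilon> * vnorm X x)"
    proof (intro bexI[OF _ \<xi>(1)] conjI allI ballI bound \<xi>)
      fix a x assume a: "a \<in> S" and x: "x \<in> vcarrier X"
      let ?d = "\<lambda>x. inner_derivation (dual_bimod X) \<xi> a x + (-1) * D a x"
      have d: "?d \<in> dual_elt X" by (intro dual_elt_lincomb inner_derivation_dual_closed \<xi> Dd)
      have "vnorm (dual_bimod X) ?d < \<epsilon>"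
        using \<xi>(3)[OF a] Dd[of a] inner_derivation_dual_closed[OF \<xi>(1), of a]
        by (simp add: vdist_def vsub_def)
      moreover have "cmod (?d x) \<le> vnorm (dual_bimod X) ?d * vnorm X x"
        unfolding dual_bimod_sel by (rule dual_norm_bound[OF d x])
      ultimately have "cmod (?d x) \<le> \<epsilon> * vnorm X x"
        using norm_nonneg[OF x] by (meson less_imp_le mult_right_mono order_trans)
      then show "cmod (\<xi> (ract X x a) - \<xi> (lact X a x) - D a x) \<le> \<epsilon> * vnorm X x"
        using x by (simp add: inner_derivation_dual)
    qed
  qed simp
qed

lemma (in banach_bimodule) continuous_derivation_dualI:
  assumes D: "\<And>a. D a \<in> dual_elt X"
    and add: "\<And>a b x. x \<in> vcarrier X \<Longrightarrow> D (a + b) x = D a x + D b x"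
    and scale: "\<And>c a x. x \<in> vcarrier X \<Longrightarrow> D (c *\<^sub>C a) x = c * D a x"
    and mult: "\<And>a b x. x \<in> vcarrier X \<Longrightarrow> D (a * b) x = D b (ract X x a) + D a (lact X b x)"
    and bound: "\<And>a x. x \<in> vcarrier X \<Longrightarrow> cmod (D a x) \<le> C * norm a * vnorm X x"
  shows "continuous_derivation (dual_bimod X) D"
proof -
  interpret Y: complex_normed_space "dual_bimod X"
    by (rule complex_normed_space_dual) unfold_locales
  interpret YM: Metric_space "dual_elt X" "vdist (dual_bimod X)"
    using Y.Metric_space_vdist by simp
  have zero: "x \<notin> vcarrier X \<Longrightarrow> D a x = 0" for a x using dual_eltD(3)[OF D] by blast
  have addD: "D (a + b) x = D a x + D b x" for a b x
    using add zero by (cases "x \<in> vcarrier X") auto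
  have scaleD: "D (c *\<^sub>C a) x = c * D a x" for c a x
    using scale zero by (cases "x \<in> vcarrier X") auto
  \<comment> \<open>The summand 1 makes \<open>B\<close> positive, so that
    \<open>\<epsilon> / B\<close> is a valid radius.\<close>
  define B where "B = \<bar>C\<bar> + 1"
  have B: "vdist (dual_bimod X) (D a) (D b) \<le> B * norm (b - a)" for a b
  proof -
    have "(SUP x\<in>vcarrier X. cmod (D a x + (-1) * D b x) / vnorm X x) \<le> B * norm (b - a)"
    proof (rule dual_norm_least)
      fix x assume x: "x \<in> vcarrier X"
      have "D b x = D (b - a) x + D a x" using addD[of "b - a" a x] by simp
      then have "cmod (D a x + (-1) * D b x) = cmod (D (b - a) x)" by (simp add: norm_minus_commute)
      also have "\<dots> \<le> C * norm (b - a) * vnorm X x" by (rule bound[OF x])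
      also have "\<dots> \<le> B * norm (b - a) * vnorm X x"
        using norm_nonneg[OF x] unfolding B_def by (intro mult_right_mono) auto
      finally show "cmod (D a x + (-1) * D b x) \<le> B * norm (b - a) * vnorm X x" .
    qed (simp add: B_def)
    then show ?thesis using D by (simp add: vdist_def vsub_def)
  qed
  have "continuous_map euclidean YM.mtopology D"
    unfolding YM.continuous_map_to_metric
  proof (intro ballI allI impI)
    fix a :: 'a and \<epsilon> :: real assume e: "0 < \<epsilon>"
    have B0: "0 < B" by (simp add: B_def)
    have "D y \<in> YM.mball (D a) \<epsilon>" if "y \<in> ball a (\<epsilon> / B)" for y
    proof -
      have "B * norm (y - a) < \<epsilon>" using that B0 by (simp add: dist_norm norm_minus_commute field_simps)
      then show ?thesis using B[of a y] D by (auto simp: YM.in_mball)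
    qed
    then show "\<exists>U. openin euclidean U \<and> a \<in> U \<and> (\<forall>y\<in>U. D y \<in> YM.mball (D a) \<epsilon>)"
      using e B0 by (intro exI[of _ "ball a (\<epsilon> / B)"]) auto
  qed
  then show ?thesis
    using D addD scaleD mult zero unfolding continuous_derivation_def vtopology_def by auto
qed

text \<open>Amenability speaks of bimodules on one universe type. A bimodule on another type is
  copied there along an injection, and \<open>inv j\<close> is applied only to recover the original
  vectors.\<close>

definition transport :: "('y \<Rightarrow> 'z) \<Rightarrow> ('a, 'y) bimod \<Rightarrow> ('a, 'z) bimod" where
  "transport j X = \<lparr>vcarrier = j ` vcarrier X, vadd = (\<lambda>x y. j (vadd X (inv j x) (inv j y))),
     vzero = j (vzero X), vscale = (\<lambda>c x. j (vscale X c (inv j x))), vnorm = (\<lambda>x. vnorm X (inv j x)),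
     lact = (\<lambda>a x. j (lact X a (inv j x))), ract = (\<lambda>x a. j (ract X (inv j x) a))\<rparr>"

lemma banach_bimodule_transport:
  fixes X :: "('a::complex_banach_algebra, 'y) bimod"
  assumes "banach_bimodule X" and j: "inj j"
  shows "banach_bimodule (transport j X)"
proof -
  interpret banach_bimodule X by fact
  note [simp] = inv_f_f[OF j] inj_eq[OF j]
  interpret T: complex_normed_space "transport j X"
    by unfold_locales
      (auto simp: transport_def add_closed zero_closed scale_closed add_assoc add_zero
        add_inverse scale_add_right scale_add_left scale_scale scale_one norm_nonneg norm_eq_zero
        norm_triangle norm_scale intro: add_commute)
  interpret M: Metric_space "vcarrier X" "vdist X" by (rule Metric_space_vdist)
  interpret TM: Metric_space "vcarrier (transport j X)" "vdist (transport j X)"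
    by (rule T.Metric_space_vdist)
  have dist: "vdist (transport j X) (j x) (j y) = vdist X x y" for x y
    using j by (auto simp: vdist_def vsub_def transport_def inj_image_mem_iff)
  have car: "vcarrier (transport j X) = j ` vcarrier X" by (simp add: transport_def)
  have "TM.mcomplete"
    unfolding TM.mcomplete_def
  proof (intro allI impI)
    fix \<sigma> assume \<sigma>: "TM.MCauchy \<sigma>"
    have rng: "range \<sigma> \<subseteq> j ` vcarrier X" using \<sigma> unfolding TM.MCauchy_def by (simp add: car)
    then have "\<forall>n. \<exists>x. x \<in> vcarrier X \<and> \<sigma> n = j x" by blast
    then obtain \<tau> where \<tau>: "\<And>n. \<tau> n \<in> vcarrier X" "\<And>n. \<sigma> n = j (\<tau> n)" by metis
    have "M.MCauchy \<tau>"
      using \<sigma> \<tau> unfolding M.MCauchy_def TM.MCauchy_def by (auto simp: dist)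
    then obtain x where x: "limitin M.mtopology \<tau> x sequentially"
      using complete by (auto simp: M.mcomplete_def)
    have "limitin TM.mtopology \<sigma> (j x) sequentially"
      using x \<tau> unfolding M.limitin_metric TM.limitin_metric by (auto simp: dist car)
    then show "\<exists>x. limitin TM.mtopology \<sigma> x sequentially" by blast
  qed
  moreover obtain C where "\<And>a x. x \<in> vcarrier X \<Longrightarrow> vnorm X (lact X a x) \<le> C * norm a * vnorm X x"
    "\<And>a x. x \<in> vcarrier X \<Longrightarrow> vnorm X (ract X x a) \<le> C * norm a * vnorm X x"
    using action_bounds by metis
  ultimately show ?thesis
    by unfold_locales
      (auto simp: transport_def lact_closed ract_closed lact_add_left lact_scale_left lact_add_right
        lact_scale_right ract_add_right ract_scale_right ract_add_left ract_scale_left lact_mult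
        ract_mult lact_ract add_closed scale_closed intro!: exI[of _ C])
qed

lemma boundedly_approximately_amenableD:
  fixes X :: "('a::complex_banach_algebra, 'y) bimod" and j :: "'y \<Rightarrow> 'a bimod_universe"
  assumes baa: "boundedly_approximately_amenable TYPE('a)" and X: "banach_bimodule X" and j: "inj j"
    and D: "\<And>a. D a \<in> dual_elt X"
    and add: "\<And>a b x. x \<in> vcarrier X \<Longrightarrow> D (a + b) x = D a x + D b x"
    and scale: "\<And>c a x. x \<in> vcarrier X \<Longrightarrow> D (c *\<^sub>C a) x = c * D a x"
    and mult: "\<And>a b x. x \<in> vcarrier X \<Longrightarrow> D (a * b) x = D b (ract X x a) + D a (lact X b x)"
    and bound: "\<And>a x. x \<in> vcarrier X \<Longrightarrow> cmod (D a x) \<le> C * norm a * vnorm X x"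
  obtains K where "0 \<le> K"
    "\<And>S \<epsilon>. finite S \<Longrightarrow> 0 < \<epsilon> \<Longrightarrow> \<exists>\<xi>\<in>dual_elt X.
       (\<forall>a. \<forall>x\<in>vcarrier X. cmod (\<xi> (ract X x a) - \<xi> (lact X a x)) \<le> K * norm a * vnorm X x) \<and>
       (\<forall>a\<in>S. \<forall>x\<in>vcarrier X. cmod (\<xi> (ract X x a) - \<xi> (lact X a x) - D a x) \<le> \<epsilon> * vnorm X x)"
proof -
  interpret banach_bimodule X by fact
  note [simp] = inv_f_f[OF j] inj_eq[OF j]
  let ?T = "transport j X"
  interpret T: banach_bimodule ?T using X j by (rule banach_bimodule_transport)
  have car: "vcarrier ?T = j ` vcarrier X" by (simp add: transport_def)
  \<comment> \<open>Dual elements vanish off the carrier, hence the value 0 outside the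
    image.\<close>
  define D' where "D' a z = (if z \<in> j ` vcarrier X then D a (inv j z) else 0)" for a z
  have D'j: "D' a (j x) = D a x" if "x \<in> vcarrier X" for a x using that by (auto simp: D'_def)
  have D'd: "D' a \<in> dual_elt ?T" for a
  proof -
    obtain C where "\<And>x. x \<in> vcarrier X \<Longrightarrow> cmod (D a x) \<le> C * vnorm X x"
      using dual_elt_bounded[OF D] by metis
    then show ?thesis
      by (intro dual_eltI[where C = C])
        (auto simp: transport_def D'_def dual_eltD[OF D] add_closed scale_closed)
  qed
  have "continuous_derivation (dual_bimod ?T) D'"
    by (rule T.continuous_derivation_dualI[OF D'd, where C = C])
      (auto simp: transport_def D'_def add scale mult bound ract_closed lact_closed)
  then have "boundedly_approximately_inner (dual_bimod ?T) D'"
    using baa T.banach_bimodule_axioms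
    unfolding boundedly_approximately_amenable_def boundedly_approximately_amenable_over_def by blast
  then obtain K where K: "0 \<le> K"
    "\<And>S \<epsilon>. finite S \<Longrightarrow> 0 < \<epsilon> \<Longrightarrow> \<exists>\<xi>\<in>dual_elt ?T.
       (\<forall>a. \<forall>x\<in>vcarrier ?T. cmod (\<xi> (ract ?T x a) - \<xi> (lact ?T a x)) \<le> K * norm a * vnorm ?T x) \<and>
       (\<forall>a\<in>S. \<forall>x\<in>vcarrier ?T. cmod (\<xi> (ract ?T x a) - \<xi> (lact ?T a x) - D' a x) \<le> \<epsilon> * vnorm ?T x)"
    using T.boundedly_approximately_innerD by blast
  show thesis
  proof (rule that[OF K(1)])
    fix S :: "'a set" and \<epsilon> :: real assume S: "finite S" "0 < \<epsilon>"
    obtain \<xi> where \<xi>: "\<xi> \<in> dual_elt ?T"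
      "\<And>a x. x \<in> vcarrier ?T \<Longrightarrow> cmod (\<xi> (ract ?T x a) - \<xi> (lact ?T a x)) \<le> K * norm a * vnorm ?T x"
      "\<And>a x. a \<in> S \<Longrightarrow> x \<in> vcarrier ?T \<Longrightarrow> cmod (\<xi> (ract ?T x a) - \<xi> (lact ?T a x) - D' a x) \<le> \<epsilon> * vnorm ?T x"
      using K(2)[OF S] by blast
    have in_T: "x \<in> vcarrier X \<Longrightarrow> j x \<in> vcarrier ?T" for x by (simp add: car)
    obtain C where C: "\<And>x. x \<in> vcarrier ?T \<Longrightarrow> cmod (\<xi> x) \<le> C * vnorm ?T x"
      using T.dual_elt_bounded[OF \<xi>(1)] by metis
    have "(\<lambda>x. \<xi> (j x)) \<in> dual_elt X"
    proof (rule dual_eltI[where C = C])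
      show "\<xi> (j (vadd X x y)) = \<xi> (j x) + \<xi> (j y)" if "x \<in> vcarrier X" "y \<in> vcarrier X" for x y
        using dual_eltD(1)[OF \<xi>(1) in_T in_T] that by (simp add: transport_def)
      show "\<xi> (j (vscale X c x)) = c * \<xi> (j x)" if "x \<in> vcarrier X" for c x
        using dual_eltD(2)[OF \<xi>(1) in_T] that by (simp add: transport_def)
      show "cmod (\<xi> (j x)) \<le> C * vnorm X x" if "x \<in> vcarrier X" for x
        using C[OF in_T[OF that]] by (simp add: transport_def)
      show "\<xi> (j x) = 0" if "x \<notin> vcarrier X" for x
        using dual_eltD(3)[OF \<xi>(1), of "j x"] that j by (simp add: car inj_image_mem_iff)
    qed
    moreover have "cmod (\<xi> (j (ract X x a)) - \<xi> (j (lact X a x))) \<le> K * norm a * vnorm X x"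
      if "x \<in> vcarrier X" for a x
      using \<xi>(2)[OF in_T[OF that], of a] by (simp add: transport_def)
    moreover have "cmod (\<xi> (j (ract X x a)) - \<xi> (j (lact X a x)) - D a x) \<le> \<epsilon> * vnorm X x"
      if "a \<in> S" "x \<in> vcarrier X" for a x
      using \<xi>(3)[OF that(1) in_T[OF that(2)]] that by (simp add: transport_def D'j)
    ultimately show "\<exists>\<xi>\<in>dual_elt X.
       (\<forall>a. \<forall>x\<in>vcarrier X. cmod (\<xi> (ract X x a) - \<xi> (lact X a x)) \<le> K * norm a * vnorm X x) \<and>
       (\<forall>a\<in>S. \<forall>x\<in>vcarrier X. cmod (\<xi> (ract X x a) - \<xi> (lact X a x) - D a x) \<le> \<epsilon> * vnorm X x)"
      by (intro bexI[of _ "\<lambda>x. \<xi> (j x)"]) auto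
  qed
qed


section \<open>Complex functionals and bilinear forms\<close>

text \<open>The type \<open>\<Rightarrow>\<^sub>L\<close> consists of real-linear bounded maps.
  Complex scalars act on it through \<open>cmul\<close> and \<open>cmul2\<close>, while
  \<open>clinear\<close> and \<open>cbilinear\<close> single out the complex-linear maps as closed
  subspaces.\<close>

definition cmul :: "complex \<Rightarrow> ('b::real_normed_vector \<Rightarrow>\<^sub>L complex) \<Rightarrow> 'b \<Rightarrow>\<^sub>L complex" where
  "cmul c f = blinfun_mult_right c o\<^sub>L f"

definition cmul2 ::
    "complex \<Rightarrow> ('b::real_normed_vector \<Rightarrow>\<^sub>L 'c::real_normed_vector \<Rightarrow>\<^sub>L complex) \<Rightarrow> 'b \<Rightarrow>\<^sub>L 'c \<Rightarrow>\<^sub>L complex" where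
  "cmul2 c b = Blinfun (cmul c) o\<^sub>L b"

definition flip_at :: "('b::real_normed_vector \<Rightarrow>\<^sub>L 'c::real_normed_vector \<Rightarrow>\<^sub>L complex) \<Rightarrow> 'c \<Rightarrow> 'b \<Rightarrow>\<^sub>L complex" where
  "flip_at b y = Blinfun (\<lambda>h. blinfun_apply h y) o\<^sub>L b"

definition precomp2 ::
    "('b::real_normed_vector \<Rightarrow>\<^sub>L 'c::real_normed_vector \<Rightarrow>\<^sub>L complex) \<Rightarrow> ('c \<Rightarrow>\<^sub>L 'c) \<Rightarrow> 'b \<Rightarrow>\<^sub>L 'c \<Rightarrow>\<^sub>L complex" where
  "precomp2 b T = Blinfun (\<lambda>h. h o\<^sub>L T) o\<^sub>L b"

definition tensor ::
    "('b::real_normed_vector \<Rightarrow>\<^sub>L complex) \<Rightarrow> ('c::real_normed_vector \<Rightarrow>\<^sub>L complex) \<Rightarrow> 'b \<Rightarrow>\<^sub>L 'c \<Rightarrow>\<^sub>L complex" where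
  "tensor f g = Blinfun (\<lambda>c. cmul c g) o\<^sub>L f"

lemma cmul_apply [simp]: "cmul c f x = c * f x"
  by (simp add: cmul_def)

lemma bounded_linear_cmul: "bounded_linear (cmul c)" "bounded_linear (\<lambda>c. cmul c f)"
  unfolding cmul_def by (intro bounded_linear_intros)+

lemma cmul2_apply [simp]: "cmul2 c b x = cmul c (b x)"
  by (simp add: cmul2_def bounded_linear_Blinfun_apply bounded_linear_cmul)

lemma flip_at_apply [simp]: "flip_at b y x = b x y"
  by (simp add: flip_at_def bounded_linear_Blinfun_apply)

lemma precomp2_apply [simp]: "precomp2 b T x = b x o\<^sub>L T"
  by (simp add: precomp2_def bounded_linear_Blinfun_apply
      bounded_bilinear.bounded_linear_left[OF bounded_bilinear_blinfun_compose])

lemma tensor_apply [simp]: "tensor f g x = cmul (f x) g"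
  by (simp add: tensor_def bounded_linear_Blinfun_apply bounded_linear_cmul)

lemma norm_cmul:
  fixes f :: "'b::real_normed_vector \<Rightarrow>\<^sub>L complex"
  shows "norm (cmul c f) = cmod c * norm f"
proof (rule antisym)
  have le: "norm (cmul c f) \<le> cmod c * norm f" for c and f :: "'b \<Rightarrow>\<^sub>L complex"
    by (rule norm_blinfun_bound) (auto simp: norm_mult mult.assoc intro!: mult_left_mono norm_blinfun)
  then show "norm (cmul c f) \<le> cmod c * norm f" .
  show "cmod c * norm f \<le> norm (cmul c f)"
  proof (cases "c = 0")
    case False
    then have "cmul (1 / c) (cmul c f) = f" by (intro blinfun_eqI) simp
    with le[of "1 / c" "cmul c f"] False show ?thesis by (simp add: norm_divide field_simps)
  qed simp
qed

lemma norm_cmul2: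
  fixes b :: "'b::real_normed_vector \<Rightarrow>\<^sub>L 'c::real_normed_vector \<Rightarrow>\<^sub>L complex"
  shows "norm (cmul2 c b) = cmod c * norm b"
proof (rule antisym)
  have le: "norm (cmul2 c b) \<le> cmod c * norm b"
    for c and b :: "'b \<Rightarrow>\<^sub>L 'c \<Rightarrow>\<^sub>L complex"
    by (rule norm_blinfun_bound) (auto simp: norm_cmul mult.assoc intro!: mult_left_mono norm_blinfun)
  then show "norm (cmul2 c b) \<le> cmod c * norm b" .
  show "cmod c * norm b \<le> norm (cmul2 c b)"
  proof (cases "c = 0")
    case False
    then have "cmul2 (1 / c) (cmul2 c b) = b" by (intro blinfun_eqI) simp
    with le[of "1 / c" "cmul2 c b"] False show ?thesis by (simp add: norm_divide field_simps)
  qed simp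
qed

lemma norm_flip_at: "norm (flip_at b y) \<le> norm b * norm y"
proof (rule norm_blinfun_bound)
  fix x
  have "norm (b x y) \<le> norm (b x) * norm y" by (rule norm_blinfun)
  also have "\<dots> \<le> norm b * norm x * norm y" by (intro mult_right_mono norm_blinfun) auto
  finally show "norm (flip_at b y x) \<le> norm b * norm y * norm x" by (simp add: mult_ac)
qed simp

lemma norm_precomp2: "norm (precomp2 b T) \<le> norm b * norm T"
proof (rule norm_blinfun_bound)
  fix x
  have "norm (b x o\<^sub>L T) \<le> norm (b x) * norm T" by (rule norm_blinfun_compose)
  also have "\<dots> \<le> norm b * norm x * norm T" by (intro mult_right_mono norm_blinfun) auto
  finally show "norm (precomp2 b T x) \<le> norm b * norm T * norm x" by (simp add: mult_ac)
qed simp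

lemma norm_tensor: "norm (tensor f g) \<le> norm f * norm g"
proof (rule norm_blinfun_bound)
  fix x
  have "norm (f x) * norm g \<le> norm f * norm x * norm g" by (intro mult_right_mono norm_blinfun) auto
  then show "norm (tensor f g x) \<le> norm f * norm g * norm x" by (simp add: norm_cmul mult_ac)
qed simp

section \<open>Complex linearity, reflexivity and norming functionals\<close>

definition clinear :: "('a::complex_banach_algebra \<Rightarrow>\<^sub>L complex) \<Rightarrow> bool" where
  "clinear f \<longleftrightarrow> (\<forall>c x. f (c *\<^sub>C x) = c * f x)"

definition cbilinear :: "('a::complex_banach_algebra \<Rightarrow>\<^sub>L 'a \<Rightarrow>\<^sub>L complex) \<Rightarrow> bool" where
  "cbilinear b \<longleftrightarrow> (\<forall>c x y. b (c *\<^sub>C x) y = c * b x y \<and> b x (c *\<^sub>C y) = c * b x y)"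

lemma clinear_add: "clinear f \<Longrightarrow> clinear g \<Longrightarrow> clinear (f + g)"
  and clinear_cmul: "clinear f \<Longrightarrow> clinear (cmul c f)"
  and clinear_zero: "clinear 0"
  by (auto simp: clinear_def blinfun.bilinear_simps algebra_simps)

lemma closed_clinear: "closed {f :: 'a::complex_banach_algebra \<Rightarrow>\<^sub>L complex. clinear f}"
  unfolding clinear_def
  by (intro closed_Collect_all closed_Collect_eq continuous_intros)

lemma closed_cbilinear: "closed {b :: 'a::complex_banach_algebra \<Rightarrow>\<^sub>L 'a \<Rightarrow>\<^sub>L complex. cbilinear b}"
  unfolding cbilinear_def
  by (intro closed_Collect_all closed_Collect_conj closed_Collect_eq continuous_intros)

lemma blinfun_of_dual_elt:
  fixes f :: "'a::complex_banach_algebra \<Rightarrow> complex"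
  assumes "f \<in> dual_elt (cspace_of TYPE('a))"
  shows "blinfun_apply (Blinfun f) = f" "clinear (Blinfun f)"
    "norm (Blinfun f) = vnorm (dual_cspace (cspace_of TYPE('a))) f"
proof -
  have add: "f (x + y) = f x + f y" and scale: "f (c *\<^sub>C x) = c * f x" for x y c
    using assms by (auto simp: dual_cspace_def cspace_of_def)
  obtain C where C: "\<And>x. cmod (f x) \<le> C * norm x"
    using assms by (auto simp: dual_cspace_def cspace_of_def)
  have "bounded_linear f"
    by (rule bounded_linear_intro[where K = C])
      (use C in \<open>auto simp: add scale scaleR_scaleC scaleR_conv_of_real mult.commute\<close>)
  then show *: "blinfun_apply (Blinfun f) = f" by (rule bounded_linear_Blinfun_apply)
  then show "clinear (Blinfun f)" by (simp add: clinear_def scale)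
  show "norm (Blinfun f) = vnorm (dual_cspace (cspace_of TYPE('a))) f"
    by (simp add: norm_blinfun.rep_eq * onorm_def dual_cspace_def cspace_of_def)
qed

lemma dual_elt_of_blinfun:
  fixes f :: "'a::complex_banach_algebra \<Rightarrow>\<^sub>L complex"
  assumes "clinear f"
  shows "blinfun_apply f \<in> dual_elt (cspace_of TYPE('a))"
  by (rule dual_eltI[where C = "norm f"])
    (use assms norm_blinfun[of f] in \<open>auto simp: cspace_of_def clinear_def blinfun.bilinear_simps\<close>)

text \<open>\<open>Blinfun\<close> identifies the carrier-based dual isometrically with the
  functionals satisfying \<open>clinear\<close>. Reflexivity is transferred along it, so that only
  the behaviour of \<Phi> on those functionals matters.\<close>

lemma reflexive_representation:
  fixes \<Phi> :: "('a::complex_banach_algebra \<Rightarrow>\<^sub>L complex) \<Rightarrow> complex"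
  assumes reflexive: "reflexive_cspace (cspace_of TYPE('a))"
    and add: "\<And>f g. clinear f \<Longrightarrow> clinear g \<Longrightarrow> \<Phi> (f + g) = \<Phi> f + \<Phi> g"
    and scale: "\<And>c f. clinear f \<Longrightarrow> \<Phi> (cmul c f) = c * \<Phi> f"
    and bound: "\<And>f. clinear f \<Longrightarrow> cmod (\<Phi> f) \<le> C * norm f"
  obtains x where "\<And>f. clinear f \<Longrightarrow> \<Phi> f = f x"
proof -
  let ?A = "cspace_of TYPE('a)"
  define \<Psi> where "\<Psi> f = (if f \<in> dual_elt ?A then \<Phi> (Blinfun f) else 0)" for f
  have sel: "vadd (dual_cspace ?A) = (\<lambda>f g x. f x + g x)" "vscale (dual_cspace ?A) = (\<lambda>c f x. c * f x)"
    by (simp_all add: dual_cspace_def)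
  have "\<Psi> \<in> dual_elt (dual_cspace ?A)"
  proof (rule dual_eltI[where C = C])
    fix f g assume f: "f \<in> dual_elt ?A" and g: "g \<in> dual_elt ?A"
    have eq: "(\<lambda>x. f x + g x) = blinfun_apply (Blinfun f + Blinfun g)"
      by (auto simp: blinfun.bilinear_simps blinfun_of_dual_elt f g)
    have cl: "clinear (Blinfun f + Blinfun g)"
      by (intro clinear_add blinfun_of_dual_elt f g)
    show "\<Psi> (vadd (dual_cspace ?A) f g) = \<Psi> f + \<Psi> g"
      unfolding sel eq \<Psi>_def
      using f g dual_elt_of_blinfun[OF cl] by (simp add: blinfun_apply_inverse add blinfun_of_dual_elt)
  next
    fix c f assume f: "f \<in> dual_elt ?A"
    have eq: "(\<lambda>x. c * f x) = blinfun_apply (cmul c (Blinfun f))"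
      by (auto simp: blinfun_of_dual_elt f)
    have cl: "clinear (cmul c (Blinfun f))"
      by (intro clinear_cmul blinfun_of_dual_elt f)
    show "\<Psi> (vscale (dual_cspace ?A) c f) = c * \<Psi> f"
      unfolding sel eq \<Psi>_def
      using f dual_elt_of_blinfun[OF cl] by (simp add: blinfun_apply_inverse scale blinfun_of_dual_elt)
  next
    fix f assume f: "f \<in> dual_elt ?A"
    then show "cmod (\<Psi> f) \<le> C * vnorm (dual_cspace ?A) f"
      using bound[of "Blinfun f"] by (simp add: \<Psi>_def blinfun_of_dual_elt)
  qed (simp add: \<Psi>_def)
  then obtain x where x: "\<And>f. f \<in> dual_elt ?A \<Longrightarrow> \<Psi> f = f x"
    using reflexive unfolding reflexive_cspace_def by blast
  show thesis
  proof (rule that)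
    fix f :: "'a \<Rightarrow>\<^sub>L complex" assume "clinear f"
    then have f: "blinfun_apply f \<in> dual_elt ?A" by (rule dual_elt_of_blinfun)
    from x[OF f] f show "\<Phi> f = f x" by (simp add: \<Psi>_def blinfun_apply_inverse)
  qed
qed

lemma norming_functional:
  fixes a :: "'a::complex_banach_algebra"
  obtains g where "clinear g" "norm g \<le> 1" "g a = norm a"
proof (cases "a = 0")
  case True
  then show ?thesis using that[of 0] clinear_zero by simp
next
  case False
  define f where "f w = (THE c. w = c *\<^sub>C a) * norm a" for w
  have f: "f (c *\<^sub>C a) = c * norm a" for c
  proof -
    have "(THE d. c *\<^sub>C a = d *\<^sub>C a) = c"
    proof (rule the_equality)
      fix d assume "c *\<^sub>C a = d *\<^sub>C a"
      then have "(c - d) *\<^sub>C a = 0" by (simp add: complex_vector.scale_left_diff_distrib)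
      then show "d = c" using False by simp
    qed simp
    then show ?thesis by (simp add: f_def)
  qed
  let ?W = "range (\<lambda>c. c *\<^sub>C a)"
  obtain F where F: "\<And>x y. F (x + y) = F x + F y" "\<And>c x. F (c *\<^sub>C x) = c * F x"
    "\<And>x. cmod (F x) \<le> norm x" "\<And>x. x \<in> ?W \<Longrightarrow> F x = f x"
  proof (rule complex_Hahn_Banach[of scaleC norm ?W f])
    show "0 \<in> ?W" by (auto intro: range_eqI[of _ _ 0])
    show "x + y \<in> ?W" if "x \<in> ?W" "y \<in> ?W" for x y
      using that by (auto simp flip: scaleC_add_left)
    show "c *\<^sub>C x \<in> ?W" if "x \<in> ?W" for c x
      using that by (auto simp: scaleC_scaleC)
    show "f (x + y) = f x + f y" if "x \<in> ?W" "y \<in> ?W" for x y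
      using that by (auto simp: f distrib_right simp flip: scaleC_add_left)
    show "f (c *\<^sub>C x) = c * f x" if "x \<in> ?W" for c x
      using that by (auto simp: f scaleC_scaleC)
    show "cmod (f x) \<le> norm x" if "x \<in> ?W" for x
      using that by (auto simp: f norm_mult norm_scaleC)
  qed (auto simp: scaleC_add_right scaleC_add_left scaleC_scaleC scaleR_scaleC
      norm_triangle_ineq norm_scaleC)
  have lin: "bounded_linear F"
    by (rule bounded_linear_intro[where K = 1])
      (use F in \<open>auto simp: scaleR_scaleC scaleR_conv_of_real\<close>)
  show ?thesis
  proof (rule that[of "Blinfun F"])
    show "clinear (Blinfun F)" by (simp add: clinear_def bounded_linear_Blinfun_apply[OF lin] F)
    show "norm (Blinfun F) \<le> 1"
      by (rule norm_blinfun_bound) (simp_all add: bounded_linear_Blinfun_apply[OF lin] F)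
    show "Blinfun F a = norm a"
      using F(4)[of a] f[of 1] by (simp add: bounded_linear_Blinfun_apply[OF lin] range_eqI[of _ _ 1])
  qed
qed

lemma clinear_separates: "(\<And>g. clinear g \<Longrightarrow> g a = 0) \<Longrightarrow> a = 0"
  by (metis norming_functional norm_eq_zero of_real_eq_0_iff)

lemma norm_le_by_functionals:
  assumes "\<And>g. clinear g \<Longrightarrow> norm g \<le> 1 \<Longrightarrow> cmod (g a) \<le> M"
  shows "norm a \<le> M"
  by (metis assms norming_functional norm_of_real abs_norm_cancel)

type_synonym 'a triple = "('a \<Rightarrow>\<^sub>L complex) \<times> ('a \<Rightarrow>\<^sub>L complex) \<times> ('a \<Rightarrow>\<^sub>L 'a \<Rightarrow>\<^sub>L complex)"

text \<open>A triple becomes a form on the unitization that vanishes at the pair of adjoined units: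
  b is its restriction to A, and f and g are its values against the unit in one argument. The
  indicator of that single form is an element of the universe.\<close>

definition triple_code :: "'a::complex_banach_algebra triple \<Rightarrow> 'a bimod_universe" where
  "triple_code = (\<lambda>(f, g, b) F.
     if F = (\<lambda>(x, s) (y, t). b x y + t * f x + s * g y) then 1 else 0)"

lemma inj_triple_code: "inj triple_code"
proof (rule injI)
  fix T T' :: "'a triple" assume eq: "triple_code T = triple_code T'"
  obtain f g b where T: "T = (f, g, b)" by (cases T)
  obtain f' g' b' where T': "T' = (f', g', b')" by (cases T')
  let ?F = "\<lambda>(x, s) (y, t). b x y + t * f x + s * g y"
  let ?F' = "\<lambda>(x, s) (y, t). b' x y + t * f' x + s * g' y"
  have "triple_code T ?F = 1" by (simp add: T triple_code_def)
  then have "triple_code T' ?F = 1" by (simp add: eq)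
  then have F: "?F = ?F'" by (simp add: T' triple_code_def split: if_splits)
  have "b x y + t * f x + s * g y = b' x y + t * f' x + s * g' y" for x y s t
    using fun_cong[OF fun_cong[OF F, of "(x, s)"], of "(y, t)"] by simp
  note * = this
  have "b x y = b' x y" "f x = f' x" "g y = g' y" for x y
    using *[where x = x and y = y and s = 0 and t = 0] *[where x = x and y = 0 and s = 0 and t = 1]
      *[where x = 0 and y = y and s = 1 and t = 0] by simp_all
  then show "T = T'" by (auto simp: T T' intro!: blinfun_eqI)
qed


section \<open>Units in kernels of characters\<close>

text \<open>There are two instances: \<phi> = 0 with p the identity, in an algebra not yet known to
  have a unit, and a character with p(a) = a - \<phi>(a) e. The law \<open>p_mult\<close> says
  precisely that a 1 = p(a) + \<phi>(a) 1 defines an action on ker \<phi> + C1.\<close>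

locale augmentation =
  fixes \<phi> :: "'a::complex_banach_algebra \<Rightarrow>\<^sub>L complex" and p :: "'a \<Rightarrow>\<^sub>L 'a"
  assumes commute: "a * b = b * (a :: 'a)"
    and \<phi>_clinear: "clinear \<phi>" and p_scaleC: "p (c *\<^sub>C a) = c *\<^sub>C p a"
    and \<phi>_mult: "\<phi> (a * b) = \<phi> a * \<phi> b"
    and \<phi>_p [simp]: "\<phi> (p a) = 0" and p_ker: "\<phi> a = 0 \<Longrightarrow> p a = a"
    and p_mult: "p (a * b) = a * p b + \<phi> b *\<^sub>C p a"
begin

definition mul_p :: "'a \<Rightarrow> 'a \<Rightarrow>\<^sub>L 'a" where
  "mul_p a = blinfun_mult_right a o\<^sub>L p"

lemma mul_p_apply [simp]: "mul_p a x = a * p x"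
  by (simp add: mul_p_def)

lemma norm_mul_p: "norm (mul_p a) \<le> norm p * norm a"
proof (rule norm_blinfun_bound)
  fix x
  have "norm (a * p x) \<le> norm a * norm (p x)" by (rule norm_mult_ineq)
  also have "\<dots> \<le> norm a * (norm p * norm x)" by (intro mult_left_mono norm_blinfun) auto
  finally show "norm (mul_p a x) \<le> norm p * norm a * norm x" by (simp add: mult_ac)
qed simp

lemma p_mul_p [simp]: "p (a * p x) = a * p x"
  by (rule p_ker) (simp add: \<phi>_mult)

lemma p_p [simp]: "p (p x) = p x"
  by (rule p_ker) simp

lemma p_mult': "p (a * b) = b * p a + \<phi> a *\<^sub>C p b"
  using p_mult[of b a] commute[of a b] by simp

text \<open>
  The predual of \<open>I \<oplus> I \<oplus> (I \<otimes> I)\<^sup>*\<^sup>*\<close> for \<open>I = ker \<phi>\<close>, whose elements stand for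
  \<open>u \<otimes> 1 + 1 \<otimes> v + M\<close>; functionals on \<open>I\<close> are pulled back along \<open>p\<close> when acted upon.
\<close>

definition predual :: "('a, 'a triple) bimod" where
  "predual = \<lparr>vcarrier = {(f, g, b). clinear f \<and> clinear g \<and> cbilinear b},
     vadd = (+), vzero = 0, vscale = (\<lambda>c (f, g, b). (cmul c f, cmul c g, cmul2 c b)), vnorm = norm,
     lact = (\<lambda>a (f, g, b). (flip_at b (p a) + cmul (\<phi> a) f, g o\<^sub>L mul_p a, precomp2 b (mul_p a))),
     ract = (\<lambda>(f, g, b) a. (f o\<^sub>L mul_p a, blinfun_apply b (p a) + cmul (\<phi> a) g, b o\<^sub>L mul_p a))\<rparr>"

lemma predual_sel [simp]:
  "(f, g, b) \<in> vcarrier predual \<longleftrightarrow> clinear f \<and> clinear g \<and> cbilinear b"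
  "vadd predual = (+)" "vzero predual = 0" "vnorm predual = norm"
  "vscale predual c (f, g, b) = (cmul c f, cmul c g, cmul2 c b)"
  "lact predual a (f, g, b) = (flip_at b (p a) + cmul (\<phi> a) f, g o\<^sub>L mul_p a, precomp2 b (mul_p a))"
  "ract predual (f, g, b) a = (f o\<^sub>L mul_p a, blinfun_apply b (p a) + cmul (\<phi> a) g, b o\<^sub>L mul_p a)"
  by (simp_all add: predual_def)

lemma norm_triple_le: "norm (f, g, b) \<le> norm f + norm g + norm b"
  using norm_Pair_le[of f "(g, b)"] norm_Pair_le[of g b] by simp

lemma norm_triple_ge: "norm f \<le> norm (f, g, b)" "norm g \<le> norm (f, g, b)" "norm b \<le> norm (f, g, b)"
  using norm_fst_le[of f "(g, b)"] norm_snd_le[of "(g, b)" f] norm_fst_le[of g b] norm_snd_le[of b g]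
  by (auto intro: order_trans)

lemma complex_normed_space_predual: "complex_normed_space predual"
proof
  fix T :: "'a triple" and c :: complex
  obtain f g b where T: "T = (f, g, b)" by (cases T)
  have "norm (cmul c f, cmul c g, cmul2 c b) = cmod c * norm (f, g, b)"
    by (simp add: norm_Pair norm_cmul norm_cmul2 power_mult_distrib real_sqrt_mult flip: distrib_left)
  then show "vnorm predual (vscale predual c T) = cmod c * vnorm predual T" by (simp add: T)
qed (auto simp: predual_def clinear_def cbilinear_def zero_prod_def blinfun.bilinear_simps algebra_simps
      norm_triangle_ineq intro!: blinfun_eqI)

text \<open>The carrier is a closed subset of a product of Banach spaces, and \<open>vdist\<close>
  agrees there with the ambient distance.\<close>

lemma complex_banach_space_predual: "complex_banach_space predual"
proof -
  interpret complex_normed_space predual by (rule complex_normed_space_predual)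
  interpret M: Metric_space "vcarrier predual" "vdist predual" by (rule Metric_space_vdist)
  have "vscale predual (-1) T = - T" for T :: "'a triple"
    by (cases T) (auto intro!: blinfun_eqI simp: blinfun.bilinear_simps)
  then have dist: "vdist predual S T = dist S T" if "S \<in> vcarrier predual" "T \<in> vcarrier predual" for S T
    using that by (simp add: vdist_def vsub_def dist_norm)
  have car: "vcarrier predual = {f. clinear f} \<times> {g. clinear g} \<times> {b. cbilinear b}"
    by (auto simp: predual_def)
  have closed: "closed (vcarrier predual)"
    unfolding car by (intro closed_Times closed_clinear closed_cbilinear)
  have "M.mcomplete"
    unfolding M.mcomplete_def
  proof (intro allI impI)
    fix \<sigma> assume \<sigma>: "M.MCauchy \<sigma>"
    then have mem: "\<sigma> n \<in> vcarrier predual" for n unfolding M.MCauchy_def by blast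
    have "Cauchy \<sigma>"
      using \<sigma> mem unfolding M.MCauchy_def Cauchy_def by (simp add: dist)
    then obtain T where T: "\<sigma> \<longlonglongrightarrow> T" using Cauchy_convergent_iff convergent_def by blast
    have "T \<in> vcarrier predual" by (rule closed_sequentially[OF closed mem T])
    moreover have "\<forall>\<^sub>F n in sequentially. dist (\<sigma> n) T < e" if "0 < e" for e
      using T that by (rule tendstoD)
    ultimately have "limitin M.mtopology \<sigma> T sequentially"
      unfolding M.limitin_metric using mem by (simp add: dist)
    then show "\<exists>T. limitin M.mtopology \<sigma> T sequentially" by blast
  qed
  then show ?thesis by unfold_locales
qed

text \<open>Each of the three components is at most
  \<open>(norm p + norm \<phi>) * norm a * norm T\<close>.\<close>

lemma norm_lact_predual: "norm (lact predual a T) \<le> 3 * (norm p + norm \<phi>) * norm a * norm T"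
proof -
  obtain f g b where T: "T = (f, g, b)" by (cases T)
  have pa: "norm (p a) \<le> norm p * norm a" and \<phi>a: "cmod (\<phi> a) \<le> norm \<phi> * norm a"
    using norm_blinfun[of p a] norm_blinfun[of \<phi> a] by auto
  have 1: "norm (flip_at b (p a) + cmul (\<phi> a) f) \<le> (norm p + norm \<phi>) * norm a * norm T"
  proof -
    have "norm (flip_at b (p a)) \<le> norm b * (norm p * norm a)"
      using norm_flip_at mult_left_mono[OF pa norm_ge_zero] by (rule order_trans)
    also have "\<dots> \<le> norm T * (norm p * norm a)" unfolding T by (intro mult_right_mono norm_triple_ge) auto
    finally have A: "norm (flip_at b (p a)) \<le> norm T * (norm p * norm a)" .
    have "cmod (\<phi> a) * norm f \<le> norm \<phi> * norm a * norm T"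
      unfolding T by (intro mult_mono \<phi>a norm_triple_ge) auto
    with A show ?thesis
      using norm_triangle_ineq[of "flip_at b (p a)" "cmul (\<phi> a) f"] by (simp add: norm_cmul algebra_simps)
  qed
  have "norm g * norm (mul_p a) \<le> norm T * (norm p * norm a)"
    unfolding T by (intro mult_mono norm_mul_p norm_triple_ge) auto
  then have 2: "norm (g o\<^sub>L mul_p a) \<le> norm T * (norm p * norm a)"
    using norm_blinfun_compose[of g "mul_p a"] by linarith
  have "norm b * norm (mul_p a) \<le> norm T * (norm p * norm a)"
    unfolding T by (intro mult_mono norm_mul_p norm_triple_ge) auto
  then have 3: "norm (precomp2 b (mul_p a)) \<le> norm T * (norm p * norm a)"
    using norm_precomp2[of b "mul_p a"] by linarith
  have "norm T * (norm p * norm a) \<le> (norm p + norm \<phi>) * norm a * norm T"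
    by (simp add: algebra_simps)
  with 1 2 3 norm_triple_le[of "flip_at b (p a) + cmul (\<phi> a) f" "g o\<^sub>L mul_p a" "precomp2 b (mul_p a)"]
  have "norm (flip_at b (p a) + cmul (\<phi> a) f, g o\<^sub>L mul_p a, precomp2 b (mul_p a)) \<le> 3 * ((norm p + norm \<phi>) * norm a * norm T)"
    by linarith
  then show ?thesis by (simp only: T predual_sel mult.assoc)
qed

lemma norm_ract_predual: "norm (ract predual T a) \<le> 3 * (norm p + norm \<phi>) * norm a * norm T"
proof -
  obtain f g b where T: "T = (f, g, b)" by (cases T)
  have pa: "norm (p a) \<le> norm p * norm a" and \<phi>a: "cmod (\<phi> a) \<le> norm \<phi> * norm a"
    using norm_blinfun[of p a] norm_blinfun[of \<phi> a] by auto
  have 1: "norm (b (p a) + cmul (\<phi> a) g) \<le> (norm p + norm \<phi>) * norm a * norm T"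
  proof -
    have "norm (b (p a)) \<le> norm b * (norm p * norm a)"
      using norm_blinfun mult_left_mono[OF pa norm_ge_zero] by (rule order_trans)
    also have "\<dots> \<le> norm T * (norm p * norm a)" unfolding T by (intro mult_right_mono norm_triple_ge) auto
    finally have A: "norm (b (p a)) \<le> norm T * (norm p * norm a)" .
    have "cmod (\<phi> a) * norm g \<le> norm \<phi> * norm a * norm T"
      unfolding T by (intro mult_mono \<phi>a norm_triple_ge) auto
    with A show ?thesis
      using norm_triangle_ineq[of "b (p a)" "cmul (\<phi> a) g"] by (simp add: norm_cmul algebra_simps)
  qed
  have "norm f * norm (mul_p a) \<le> norm T * (norm p * norm a)"
    unfolding T by (intro mult_mono norm_mul_p norm_triple_ge) auto
  then have 2: "norm (f o\<^sub>L mul_p a) \<le> norm T * (norm p * norm a)"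
    using norm_blinfun_compose[of f "mul_p a"] by linarith
  have "norm b * norm (mul_p a) \<le> norm T * (norm p * norm a)"
    unfolding T by (intro mult_mono norm_mul_p norm_triple_ge) auto
  then have 3: "norm (b o\<^sub>L mul_p a) \<le> norm T * (norm p * norm a)"
    using norm_blinfun_compose[of b "mul_p a"] by linarith
  have "norm T * (norm p * norm a) \<le> (norm p + norm \<phi>) * norm a * norm T"
    by (simp add: algebra_simps)
  with 1 2 3 norm_triple_le[of "f o\<^sub>L mul_p a" "b (p a) + cmul (\<phi> a) g" "b o\<^sub>L mul_p a"]
  have "norm (f o\<^sub>L mul_p a, b (p a) + cmul (\<phi> a) g, b o\<^sub>L mul_p a) \<le> 3 * ((norm p + norm \<phi>) * norm a * norm T)"
    by linarith
  then show ?thesis by (simp only: T predual_sel mult.assoc)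
qed

lemma banach_bimodule_predual: "banach_bimodule predual"
proof -
  interpret complex_banach_space predual by (rule complex_banach_space_predual)
  have \<phi>s: "\<phi> (c *\<^sub>C a) = c * \<phi> a" for c a using \<phi>_clinear by (simp add: clinear_def)
  have swap: "a * (b * c) = b * (a * c)" for a b c :: 'a by (metis commute mult.assoc)
  note ac = mult.assoc swap
  show ?thesis
  proof
    \<comment> \<open>The dual right action multiplies the second leg, written as multiplication
      from the left. The factors therefore appear in reversed order, and \<open>p (a * b)\<close> is
      expanded through commutativity by \<open>p_mult'\<close>.\<close>
    show "lact predual (a * b) T = lact predual a (lact predual b T)" if "T \<in> vcarrier predual" for a b T
      using that by (auto simp: predual_def cbilinear_def blinfun.bilinear_simps \<phi>_mult p_mult'[of a b] ac
          distrib_left intro!: blinfun_eqI)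
    show "\<exists>C. \<forall>a. \<forall>T\<in>vcarrier predual. vnorm predual (lact predual a T) \<le> C * norm a * vnorm predual T"
      by (intro exI allI ballI) (simp only: predual_sel, rule norm_lact_predual)
    show "\<exists>C. \<forall>a. \<forall>T\<in>vcarrier predual. vnorm predual (ract predual T a) \<le> C * norm a * vnorm predual T"
      by (intro exI allI ballI) (simp only: predual_sel, rule norm_ract_predual)
  qed (auto simp: predual_def clinear_def cbilinear_def blinfun.bilinear_simps \<phi>s \<phi>_mult p_scaleC
      p_mult mult_scaleC_left mult_scaleC_right ac distrib_left distrib_right
      intro!: blinfun_eqI)
qed

text \<open>
  The derivation \<open>a \<mapsto> a \<otimes> 1 - 1 \<otimes> a\<close>, which would be inner if \<open>1 \<otimes> 1\<close> belonged to the module.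
\<close>

definition diag_derivation :: "'a \<Rightarrow> 'a triple \<Rightarrow> complex" where
  "diag_derivation a = (\<lambda>(f, g, b). if (f, g, b) \<in> vcarrier predual then f (p a) - g (p a) else 0)"

lemma diag_derivation_bound: "cmod (diag_derivation a T) \<le> 2 * norm p * norm a * norm T"
proof (cases "T \<in> vcarrier predual")
  case True
  obtain f g b where T: "T = (f, g, b)" by (cases T)
  have pa: "norm (p a) \<le> norm p * norm a" by (rule norm_blinfun)
  have "cmod (f (p a)) \<le> norm f * norm (p a)" by (rule norm_blinfun)
  also have "\<dots> \<le> norm T * (norm p * norm a)" unfolding T by (intro mult_mono pa norm_triple_ge) auto
  finally have 1: "cmod (f (p a)) \<le> norm T * (norm p * norm a)" .
  have "cmod (g (p a)) \<le> norm g * norm (p a)" by (rule norm_blinfun)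
  also have "\<dots> \<le> norm T * (norm p * norm a)" unfolding T by (intro mult_mono pa norm_triple_ge) auto
  finally have 2: "cmod (g (p a)) \<le> norm T * (norm p * norm a)" .
  have "diag_derivation a T = f (p a) - g (p a)" using True T by (simp add: diag_derivation_def)
  then show ?thesis using 1 2 norm_triangle_ineq4[of "f (p a)" "g (p a)"] by (simp add: mult_ac)
qed (auto simp: diag_derivation_def split: prod.splits)

lemma approximate_diagonal:
  assumes baa: "boundedly_approximately_amenable TYPE('a)"
  obtains K where "0 \<le> K"
    "\<And>S \<epsilon>. finite S \<Longrightarrow> 0 < \<epsilon> \<Longrightarrow> \<exists>\<xi>\<in>dual_elt predual.
       (\<forall>a. \<forall>T\<in>vcarrier predual. cmod (\<xi> (ract predual T a) - \<xi> (lact predual a T)) \<le> K * norm a * norm T) \<and>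
       (\<forall>a\<in>S. \<forall>T\<in>vcarrier predual.
          cmod (\<xi> (ract predual T a) - \<xi> (lact predual a T) - diag_derivation a T) \<le> \<epsilon> * norm T)"
proof (rule boundedly_approximately_amenableD[OF baa banach_bimodule_predual inj_triple_code,
      of diag_derivation "2 * norm p"])
  interpret banach_bimodule predual by (rule banach_bimodule_predual)
  show "diag_derivation a \<in> dual_elt predual" for a
  proof (rule dual_eltI[where C = "2 * norm p * norm a"])
    show "diag_derivation a (vscale predual c T) = c * diag_derivation a T" if "T \<in> vcarrier predual" for c T
      using that scale_closed[OF that, of c]
      by (cases T) (simp add: diag_derivation_def algebra_simps)
    show "diag_derivation a (vadd predual S T) = diag_derivation a S + diag_derivation a T"
      if "S \<in> vcarrier predual" "T \<in> vcarrier predual" for S T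
      using that add_closed[OF that]
      by (cases S; cases T) (simp add: diag_derivation_def blinfun.bilinear_simps)
    show "cmod (diag_derivation a T) \<le> 2 * norm p * norm a * vnorm predual T" for T
      using diag_derivation_bound by simp
    show "T \<notin> vcarrier predual \<Longrightarrow> diag_derivation a T = 0" for T
      by (cases T) (auto simp: diag_derivation_def)
  qed
  fix a b T assume T: "T \<in> vcarrier predual"
  show "diag_derivation (a + b) T = diag_derivation a T + diag_derivation b T"
    by (cases T) (simp add: diag_derivation_def blinfun.bilinear_simps)
  show "diag_derivation (c *\<^sub>C a) T = c * diag_derivation a T" for c
    using T by (cases T) (simp add: diag_derivation_def p_scaleC clinear_def algebra_simps)
  show "diag_derivation (a * b) T = diag_derivation b (ract predual T a) + diag_derivation a (lact predual b T)"
  proof -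
    obtain f g h where fgh: "T = (f, g, h)" by (cases T)
    have "f (p (a * b)) = f (a * p b) + \<phi> b * f (p a)"
      using T fgh p_mult[of a b] by (auto simp: clinear_def blinfun.bilinear_simps)
    moreover have "g (p (a * b)) = g (b * p a) + \<phi> a * g (p b)"
      using T fgh p_mult'[of a b] by (auto simp: clinear_def blinfun.bilinear_simps)
    ultimately show ?thesis
      using T fgh ract_closed[OF T, of a] lact_closed[OF T, of b]
      by (simp add: diag_derivation_def blinfun.bilinear_simps)
  qed
  show "cmod (diag_derivation a T) \<le> 2 * norm p * norm a * vnorm predual T"
    using diag_derivation_bound by simp
qed (use that in auto)

lemma clinear_mul_p: "clinear f \<Longrightarrow> clinear (f o\<^sub>L mul_p a)"
  and clinear_p: "clinear f \<Longrightarrow> clinear (f o\<^sub>L p)"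
  and clinear_mult: "clinear f \<Longrightarrow> clinear (f o\<^sub>L blinfun_mult_right a)"
  and cbilinear_tensor: "clinear f \<Longrightarrow> clinear g \<Longrightarrow> cbilinear (tensor f g)"
  and cbilinear_zero: "cbilinear 0"
  by (auto simp: clinear_def cbilinear_def p_scaleC mult_scaleC_right)

text \<open>
  The element \<open>u\<close> is the component of \<open>\<xi>\<close> at \<open>I \<otimes> 1\<close>. In the last estimate \<open>a\<close> is to be chosen
  almost orthogonal to \<open>e\<close> and to \<open>n\<close>, so that \<open>e u\<close> is bounded independently of \<open>u\<close>: the functional
  in the first leg is kept fixed, while the one in the second leg may depend on \<open>a\<close>.
\<close>

lemma element_of_functional:
  assumes reflexive: "reflexive_cspace (cspace_of TYPE('a))"
    and \<xi>: "\<xi> \<in> dual_elt predual" and K: "0 \<le> K"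
    and inner: "\<And>a T. T \<in> vcarrier predual \<Longrightarrow>
      cmod (\<xi> (ract predual T a) - \<xi> (lact predual a T)) \<le> K * norm a * norm T"
    and approx: "\<And>a T. a \<in> S \<Longrightarrow> T \<in> vcarrier predual \<Longrightarrow>
      cmod (\<xi> (ract predual T a) - \<xi> (lact predual a T) - diag_derivation a T) \<le> \<epsilon> * norm T"
    and S: "\<And>a. a \<in> S \<Longrightarrow> \<phi> a = 0" and \<epsilon>: "0 \<le> \<epsilon>"
  obtains u where "\<phi> u = 0" "\<And>a. \<phi> a = 0 \<Longrightarrow> norm (a * u) \<le> K * norm a"
    "\<And>a. a \<in> S \<Longrightarrow> norm (a * u - a) \<le> \<epsilon>"
    "\<And>e. \<phi> e = 0 \<Longrightarrow> (\<And>x. \<phi> x = 0 \<Longrightarrow> norm (e * x) \<le> K * norm x) \<Longrightarrow>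
       \<exists>n c. \<phi> n = 0 \<and> 0 \<le> c \<and> (\<forall>a. \<phi> a = 0 \<longrightarrow>
         norm a * norm (e * u) \<le> K * K * norm p * norm a + c * norm (e * a) + norm (a * n))"
proof -
  interpret banach_bimodule predual by (rule banach_bimodule_predual)
  obtain C where C: "0 \<le> C" "\<And>T. T \<in> vcarrier predual \<Longrightarrow> cmod (\<xi> T) \<le> C * norm T"
    using dual_elt_bounded[OF \<xi>] by auto
  have add: "\<xi> (T + T') = \<xi> T + \<xi> T'" if "T \<in> vcarrier predual" "T' \<in> vcarrier predual" for T T'
    using dual_eltD(1)[OF \<xi> that] by simp
  have scale: "\<xi> (cmul c f, cmul c g, cmul2 c b) = c * \<xi> (f, g, b)" if "(f, g, b) \<in> vcarrier predual" for c f g b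
    using dual_eltD(2)[OF \<xi> that, of c] by simp
  note cl = clinear_zero cbilinear_zero clinear_p clinear_mult clinear_mul_p clinear_cmul cbilinear_tensor clinear_add
  have cmul0: "cmul c 0 = 0" "cmul2 c 0 = 0" "cmul 0 f = 0" for c :: complex and f :: "'a \<Rightarrow>\<^sub>L complex"
    by (auto intro!: blinfun_eqI)
  \<comment> \<open>Reflexivity turns the first component of \<xi> into an element. Pulling
    functionals back along \<open>p\<close> places it in the kernel, because
    \<open>\<phi> o\<^sub>L p\<close> is 0.\<close>
  obtain u where u: "\<And>f. clinear f \<Longrightarrow> \<xi> (f o\<^sub>L p, 0, 0) = f u"
  proof (rule reflexive_representation[OF reflexive, where \<Phi> = "\<lambda>f. \<xi> (f o\<^sub>L p, 0, 0)" and C = "C * norm p"])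
    fix f g :: "'a \<Rightarrow>\<^sub>L complex" and c assume f: "clinear f"
    show "\<xi> (cmul c f o\<^sub>L p, 0, 0) = c * \<xi> (f o\<^sub>L p, 0, 0)"
    proof -
      have "cmul c f o\<^sub>L p = cmul c (f o\<^sub>L p)" by (auto intro!: blinfun_eqI)
      with scale[of "f o\<^sub>L p" 0 0 c] f show ?thesis by (simp add: cl cmul0)
    qed
    show "cmod (\<xi> (f o\<^sub>L p, 0, 0)) \<le> C * norm p * norm f"
    proof -
      have "cmod (\<xi> (f o\<^sub>L p, 0, 0)) \<le> C * norm (f o\<^sub>L p)"
        using C(2)[of "(f o\<^sub>L p, 0, 0)"] f by (simp add: cl norm_Pair)
      also have "\<dots> \<le> C * (norm f * norm p)" using C(1) by (intro mult_left_mono norm_blinfun_compose)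
      finally show ?thesis by (simp add: mult_ac)
    qed
    assume g: "clinear g"
    have "(f + g) o\<^sub>L p = (f o\<^sub>L p) + (g o\<^sub>L p)" by (auto intro!: blinfun_eqI simp: blinfun.bilinear_simps)
    with add[of "(f o\<^sub>L p, 0, 0)" "(g o\<^sub>L p, 0, 0)"] f g
    show "\<xi> ((f + g) o\<^sub>L p, 0, 0) = \<xi> (f o\<^sub>L p, 0, 0) + \<xi> (g o\<^sub>L p, 0, 0)" by (simp add: cl)
  qed (use that in auto)
  have \<xi>0: "\<xi> (0, 0, 0) = 0"
    using add[of "(0, 0, 0)" "(0, 0, 0)"] by (simp add: cl)
  have "\<phi> o\<^sub>L p = 0" by (auto intro!: blinfun_eqI)
  then have \<phi>u: "\<phi> u = 0" using u[OF \<phi>_clinear] \<xi>0 by simp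
  have mul_p_eq: "f o\<^sub>L mul_p a = (f o\<^sub>L blinfun_mult_right a) o\<^sub>L p" for f :: "'a \<Rightarrow>\<^sub>L complex" and a
    by (auto intro!: blinfun_eqI)
  have ad_first: "\<xi> (ract predual (f, 0, 0) a) - \<xi> (lact predual a (f, 0, 0)) = f (a * u)"
    if f: "clinear f" and a: "\<phi> a = 0" for f a
  proof -
    have "ract predual (f, 0, 0) a = ((f o\<^sub>L blinfun_mult_right a) o\<^sub>L p, 0, 0)"
      by (simp add: mul_p_eq cmul0 a)
    moreover have "lact predual a (f, 0, 0) = (0, 0, 0)"
      by (auto intro!: blinfun_eqI simp: a blinfun.bilinear_simps)
    ultimately show ?thesis using u[OF clinear_mult[OF f], of a] \<xi>0 by simp
  qed
  have mult_bound: "norm (a * u) \<le> K * norm a" if a: "\<phi> a = 0" for a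
  proof (rule norm_le_by_functionals)
    fix f :: "'a \<Rightarrow>\<^sub>L complex" assume f: "clinear f" "norm f \<le> 1"
    have "cmod (f (a * u)) \<le> K * norm a * norm f"
      using inner[of "(f, 0, 0)" a] ad_first[OF f(1) a] f by (simp add: cl norm_Pair del: predual_sel(6,7))
    also have "\<dots> \<le> K * norm a * 1" using f(2) K by (intro mult_left_mono) auto
    finally show "cmod (f (a * u)) \<le> K * norm a" by simp
  qed
  have approx_unit: "norm (a * u - a) \<le> \<epsilon>" if a: "a \<in> S" for a
  proof (rule norm_le_by_functionals)
    fix f :: "'a \<Rightarrow>\<^sub>L complex" assume f: "clinear f" "norm f \<le> 1"
    have "cmod (f (a * u) - f a) \<le> \<epsilon> * norm f"
      using approx[OF a, of "(f, 0, 0)"] ad_first[OF f(1) S[OF a]] f p_ker[OF S[OF a]]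
      by (simp add: cl norm_Pair diag_derivation_def del: predual_sel(6,7))
    also have "\<dots> \<le> \<epsilon> * 1" using f(2) \<epsilon> by (intro mult_left_mono) auto
    finally show "cmod (f (a * u - a)) \<le> \<epsilon>" by (simp add: blinfun.bilinear_simps)
  qed
  have "\<exists>n c. \<phi> n = 0 \<and> 0 \<le> c \<and> (\<forall>a. \<phi> a = 0 \<longrightarrow>
         norm a * norm (e * u) \<le> K * K * norm p * norm a + c * norm (e * a) + norm (a * n))"
    if e: "\<phi> e = 0" and eK: "\<And>x. \<phi> x = 0 \<Longrightarrow> norm (e * x) \<le> K * norm x" for e
  proof -
    obtain h where h: "clinear h" "norm h \<le> 1" "h (e * u) = norm (e * u)"
      using norming_functional by blast
    have h_le: "cmod (h x) \<le> norm x" for x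
    proof -
      have "cmod (h x) \<le> norm h * norm x" by (rule norm_blinfun)
      also have "\<dots> \<le> 1 * norm x" using h(2) by (intro mult_right_mono) auto
      finally show ?thesis by simp
    qed
    \<comment> \<open>Only the multiplier bound of \<open>e\<close> enters the norm of
      \<open>f\<close>, so \<open>norm e\<close> does not enter
      \<open>K * K * norm p\<close>.\<close>
    define f where "f = h o\<^sub>L mul_p e"
    have f: "clinear f" unfolding f_def by (intro cl h)
    have norm_f: "norm f \<le> K * norm p"
    proof (rule norm_blinfun_bound)
      fix x
      have "cmod (f x) \<le> norm (e * p x)" using h_le by (simp add: f_def)
      also have "\<dots> \<le> K * norm (p x)" by (intro eK) simp
      also have "\<dots> \<le> K * (norm p * norm x)" using K by (intro mult_left_mono norm_blinfun)
      finally show "cmod (f x) \<le> K * norm p * norm x" by (simp add: mult_ac)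
    qed (use K in simp)
    have \<xi>f: "\<xi> (f, 0, 0) = norm (e * u)"
      using u[OF clinear_mult[OF h(1)], of e] h(3) by (simp add: f_def mul_p_eq)
    have tensor_bound: "cmod (\<xi> (0, 0, tensor f' g)) \<le> C * (norm f' * norm g)"
      if "clinear f'" "clinear g" for f' g
    proof -
      have "cmod (\<xi> (0, 0, tensor f' g)) \<le> C * norm (tensor f' g)"
        using C(2)[of "(0, 0, tensor f' g)"] that by (simp add: cl norm_Pair)
      also have "\<dots> \<le> C * (norm f' * norm g)" using C(1) by (intro mult_left_mono norm_tensor)
      finally show ?thesis .
    qed
    \<comment> \<open>The form component of \<xi>, with \<open>f\<close> fixed in the first leg, is
      again an element by reflexivity. Leaving \<open>g\<close> free here makes \<open>n\<close>
      independent of \<open>a\<close>.\<close>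
    obtain n where n: "\<And>g. clinear g \<Longrightarrow> \<xi> (0, 0, tensor f (g o\<^sub>L p)) = g n"
    proof (rule reflexive_representation[OF reflexive,
          where \<Phi> = "\<lambda>g. \<xi> (0, 0, tensor f (g o\<^sub>L p))" and C = "C * (norm f * norm p)"])
      fix g g' :: "'a \<Rightarrow>\<^sub>L complex" and c assume g: "clinear g"
      have "tensor f (cmul c g o\<^sub>L p) = cmul2 c (tensor f (g o\<^sub>L p))"
        by (auto intro!: blinfun_eqI)
      with scale[of 0 0 "tensor f (g o\<^sub>L p)" c] g f
      show "\<xi> (0, 0, tensor f (cmul c g o\<^sub>L p)) = c * \<xi> (0, 0, tensor f (g o\<^sub>L p))"
        by (simp add: cl cmul0)
      have "cmod (\<xi> (0, 0, tensor f (g o\<^sub>L p))) \<le> C * (norm f * norm (g o\<^sub>L p))"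
        by (intro tensor_bound cl f g)
      also have "\<dots> \<le> C * (norm f * (norm g * norm p))"
        using C(1) by (intro mult_left_mono norm_blinfun_compose) auto
      finally show "cmod (\<xi> (0, 0, tensor f (g o\<^sub>L p))) \<le> C * (norm f * norm p) * norm g"
        by (simp add: mult_ac)
      assume g': "clinear g'"
      have "tensor f ((g + g') o\<^sub>L p) = tensor f (g o\<^sub>L p) + tensor f (g' o\<^sub>L p)"
        by (auto intro!: blinfun_eqI simp: blinfun.bilinear_simps algebra_simps)
      with add[of "(0, 0, tensor f (g o\<^sub>L p))" "(0, 0, tensor f (g' o\<^sub>L p))"] f g g'
      show "\<xi> (0, 0, tensor f ((g + g') o\<^sub>L p)) =
          \<xi> (0, 0, tensor f (g o\<^sub>L p)) + \<xi> (0, 0, tensor f (g' o\<^sub>L p))"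
        by (simp add: cl)
    qed (use that in auto)
    have "tensor f (\<phi> o\<^sub>L p) = 0" by (auto intro!: blinfun_eqI)
    then have \<phi>n: "\<phi> n = 0" using n[OF \<phi>_clinear] \<xi>0 by simp
    \<comment> \<open>The summand 1 accounts for the component of \<xi> at 1 \<otimes> I, and
      \<open>norm p\<close> for the one at I \<otimes> I. Both terms contain \<open>f\<close>
      evaluated at multiples of \<open>a\<close>, hence the factor
      \<open>norm (e * a)\<close>.\<close>
    define c where "c = C * (1 + norm p)"
    have "norm a * norm (e * u) \<le> K * K * norm p * norm a + c * norm (e * a) + norm (a * n)"
      if a: "\<phi> a = 0" for a
    proof -
      \<comment> \<open>With this \<open>g\<close> the left action contributes
        \<open>g a * \<xi> (f, 0, 0)\<close>, which is the product to be bounded.\<close>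
      obtain g where g: "clinear g" "norm g \<le> 1" "g a = norm a" using norming_functional by blast
      have pa: "p a = a" using a by (rule p_ker)
      let ?T = "(0, 0, tensor f g)"
      have "ract predual ?T a = (0, cmul (f a) g, 0) + (0, 0, tensor (f o\<^sub>L mul_p a) g)"
        by (auto intro!: blinfun_eqI simp: pa a)
      then have 1: "\<xi> (ract predual ?T a) = f a * \<xi> (0, g, 0) + \<xi> (0, 0, tensor (f o\<^sub>L mul_p a) g)"
        using add[of "(0, cmul (f a) g, 0)" "(0, 0, tensor (f o\<^sub>L mul_p a) g)"] f g(1)
          scale[of 0 g 0 "f a"] by (simp add: cl cmul0)
      have "lact predual a ?T = (cmul (g a) f, 0, 0) + (0, 0, tensor f ((g o\<^sub>L blinfun_mult_right a) o\<^sub>L p))"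
        by (auto intro!: blinfun_eqI simp: pa a blinfun.bilinear_simps)
      then have 2: "\<xi> (lact predual a ?T) = complex_of_real (norm a * norm (e * u)) + g (a * n)"
        using add[of "(cmul (g a) f, 0, 0)" "(0, 0, tensor f ((g o\<^sub>L blinfun_mult_right a) o\<^sub>L p))"] f g
          scale[of f 0 0 "g a"] n[OF clinear_mult[OF g(1)], of a] by (simp add: cl cmul0 \<xi>f)
      have "norm (tensor f g) \<le> K * norm p"
      proof -
        have "norm f * norm g \<le> norm f * 1" using g(2) by (intro mult_left_mono) auto
        with norm_tensor[of f g] norm_f show ?thesis by linarith
      qed
      then have "K * norm a * norm (tensor f g) \<le> K * norm a * (K * norm p)"
        using K by (intro mult_left_mono) auto
      then have 3: "cmod (\<xi> (ract predual ?T a) - \<xi> (lact predual a ?T)) \<le> K * K * norm p * norm a"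
        using inner[of ?T a] f g(1) by (simp add: cl norm_Pair mult_ac del: predual_sel(6,7))
      have fa: "cmod (f a) \<le> norm (e * a)" using h_le[of "e * a"] pa by (simp add: f_def)
      have "cmod (\<xi> (0, g, 0)) \<le> C * norm g" using C(2)[of "(0, g, 0)"] g by (simp add: cl norm_Pair)
      also have "\<dots> \<le> C * 1" using g(2) C(1) by (intro mult_left_mono) auto
      finally have "cmod (f a * \<xi> (0, g, 0)) \<le> norm (e * a) * C"
        using fa C(1) by (simp add: norm_mult mult_mono)
      moreover have "cmod (\<xi> (0, 0, tensor (f o\<^sub>L mul_p a) g)) \<le> C * (norm (e * a) * norm p)"
      proof -
        have "norm (f o\<^sub>L mul_p a) \<le> norm (e * a) * norm p"
        proof (rule norm_blinfun_bound)
          fix x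
          have "cmod ((f o\<^sub>L mul_p a) x) \<le> norm (e * a * p x)"
            using h_le[of "e * (a * p x)"] by (simp add: f_def mult.assoc)
          also have "\<dots> \<le> norm (e * a) * norm (p x)" by (rule norm_mult_ineq)
          also have "\<dots> \<le> norm (e * a) * (norm p * norm x)" by (intro mult_left_mono norm_blinfun) auto
          finally show "cmod ((f o\<^sub>L mul_p a) x) \<le> norm (e * a) * norm p * norm x" by (simp add: mult_ac)
        qed simp
        then have "norm (f o\<^sub>L mul_p a) * norm g \<le> (norm (e * a) * norm p) * 1"
          using g(2) by (intro mult_mono) auto
        then have "C * (norm (f o\<^sub>L mul_p a) * norm g) \<le> C * (norm (e * a) * norm p)"
          using C(1) by (intro mult_left_mono) auto
        moreover have "cmod (\<xi> (0, 0, tensor (f o\<^sub>L mul_p a) g)) \<le> C * (norm (f o\<^sub>L mul_p a) * norm g)"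
          by (intro tensor_bound cl f g)
        ultimately show ?thesis by linarith
      qed
      moreover have "cmod (g (a * n)) \<le> norm (a * n)"
      proof -
        have "cmod (g (a * n)) \<le> norm g * norm (a * n)" by (rule norm_blinfun)
        also have "\<dots> \<le> 1 * norm (a * n)" using g(2) by (intro mult_right_mono) auto
        finally show ?thesis by simp
      qed
      moreover have "norm a * norm (e * u) \<le> cmod (\<xi> (ract predual ?T a) - \<xi> (lact predual a ?T)) +
          cmod (f a * \<xi> (0, g, 0)) + cmod (\<xi> (0, 0, tensor (f o\<^sub>L mul_p a) g)) + cmod (g (a * n))"
      proof -
        let ?L = "\<xi> (ract predual ?T a) - \<xi> (lact predual a ?T)"
        have eq: "complex_of_real (norm a * norm (e * u)) =
            f a * \<xi> (0, g, 0) + \<xi> (0, 0, tensor (f o\<^sub>L mul_p a) g) - g (a * n) - ?L"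
          unfolding 1 2 by simp
        have "norm a * norm (e * u) = cmod (complex_of_real (norm a * norm (e * u)))"
          by (simp only: norm_of_real abs_of_nonneg mult_nonneg_nonneg norm_ge_zero)
        also have "\<dots> \<le> cmod (f a * \<xi> (0, g, 0)) + cmod (\<xi> (0, 0, tensor (f o\<^sub>L mul_p a) g)) + cmod (g (a * n)) + cmod ?L"
          unfolding eq by (intro order_trans[OF norm_triangle_ineq4] add_right_mono norm_triangle_ineq)
        finally show ?thesis by linarith
      qed
      ultimately have "norm a * norm (e * u) \<le> K * K * norm p * norm a + norm (e * a) * C + C * (norm (e * a) * norm p) + norm (a * n)"
        using 3 by linarith
      also have "\<dots> = K * K * norm p * norm a + c * norm (e * a) + norm (a * n)"
        by (simp add: c_def algebra_simps)
      finally show ?thesis .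
    qed
    moreover have "0 \<le> c" using C(1) by (simp add: c_def)
    ultimately show ?thesis using \<phi>n by blast
  qed
  then show thesis using that \<phi>u mult_bound approx_unit by blast
qed

section \<open>From approximate identities to units\<close>

lemma kernel_diff: "\<phi> a = 0 \<Longrightarrow> \<phi> b = 0 \<Longrightarrow> \<phi> (a - b) = 0"
  by (simp add: blinfun.bilinear_simps)

text \<open>
  A bounded approximate identity converges weakly by reflexivity; Hahn-Banach on the dual replaces
  the choice of a weakly convergent subnet.
\<close>

lemma unit_of_bounded_approximate_identity:
  assumes reflexive: "reflexive_cspace (cspace_of TYPE('a))"
    and u: "\<And>S. finite S \<Longrightarrow> S \<subseteq> {a. \<phi> a = 0} \<Longrightarrow>
      \<exists>u. \<phi> u = 0 \<and> norm u \<le> L \<and> (\<forall>a\<in>S. norm (a * u - a) \<le> 1)"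
  obtains w where "\<phi> w = 0" "\<And>a. \<phi> a = 0 \<Longrightarrow> a * w = a"
proof -
  let ?I = "{a. \<phi> a = 0}"
  define U where "U S = (SOME u. \<phi> u = 0 \<and> norm u \<le> L \<and> (\<forall>a\<in>S. norm (a * u - a) \<le> 1))" for S
  have U: "\<phi> (U S) = 0" "norm (U S) \<le> L" "\<And>a. a \<in> S \<Longrightarrow> norm (a * U S - a) \<le> 1"
    if "finite S" "S \<subseteq> ?I" for S
    using someI_ex[OF u[OF that]] unfolding U_def by blast+
  let ?F = "finite_subsets_at_top ?I"
  have L: "0 \<le> L" using U(2)[of "{}"] norm_ge_zero order_trans by blast
  have ev: "\<forall>\<^sub>F S in ?F. finite S \<and> S \<subseteq> ?I" by (rule eventually_finite_subsets_at_top_weakI) auto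
  let ?lim = "\<lambda>f l. ((\<lambda>S. blinfun_apply f (U S)) \<longlongrightarrow> l) ?F"
  have lim_unique: "l = l'" if "?lim f l" "?lim f l'" for f l l'
    by (rule tendsto_unique[OF finite_subsets_at_top_neq_bot that])
  define lm where "lm f = (THE l. ?lim f l)" for f :: "'a \<Rightarrow>\<^sub>L complex"
  have lm: "lm f = l" if "?lim f l" for f l
    unfolding lm_def using that lim_unique by blast
  have lim_add: "?lim (f + g) (l + m)" if "?lim f l" "?lim g m" for f g l m
    using tendsto_add[OF that] by (simp add: blinfun.bilinear_simps)
  have lim_cmul: "?lim (cmul c f) (c * l)" if "?lim f l" for c f l
    using tendsto_mult[OF tendsto_const that] by simp
  have lim_bound: "cmod l \<le> L * norm f" if "?lim f l" for f l
  proof (rule tendsto_upperbound[OF tendsto_norm[OF that]])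
    show "\<forall>\<^sub>F S in ?F. cmod (f (U S)) \<le> L * norm f"
      using ev
    proof eventually_elim
      case (elim S)
      have "cmod (f (U S)) \<le> norm f * norm (U S)" by (rule norm_blinfun)
      also have "\<dots> \<le> norm f * L" using U(2) elim by (intro mult_left_mono) auto
      finally show ?case by (simp add: mult.commute)
    qed
  qed simp
  \<comment> \<open>\<open>?W\<close> contains \<phi>, with limit 0, and all g(a x) with \<phi>(a) =
    0 and g complex linear, with limit g(a). These values already determine that the representing
    element is a unit of the kernel, whichever extension is taken.\<close>
  let ?W = "{f. \<exists>l. ?lim f l}"
  obtain \<Phi> :: "('a \<Rightarrow>\<^sub>L complex) \<Rightarrow> complex" where \<Phi>: "\<And>f g. \<Phi> (f + g) = \<Phi> f + \<Phi> g"
    "\<And>c f. \<Phi> (cmul c f) = c * \<Phi> f" "\<And>f. cmod (\<Phi> f) \<le> L * norm f" "\<And>f. f \<in> ?W \<Longrightarrow> \<Phi> f = lm f"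
  proof (rule complex_Hahn_Banach[of cmul "\<lambda>f. L * norm f" ?W lm])
    show "0 \<in> ?W" by (auto intro!: exI[of _ 0])
    show "f + g \<in> ?W" if "f \<in> ?W" "g \<in> ?W" for f g using that lim_add by blast
    show "cmul c f \<in> ?W" if "f \<in> ?W" for c f using that lim_cmul by blast
    show "lm (f + g) = lm f + lm g" if "f \<in> ?W" "g \<in> ?W" for f g
    proof -
      from that obtain l m where "?lim f l" "?lim g m" by blast
      with lm lim_add show ?thesis by metis
    qed
    show "lm (cmul c f) = c * lm f" if "f \<in> ?W" for c f
    proof -
      from that obtain l where "?lim f l" by blast
      with lm lim_cmul show ?thesis by metis
    qed
    show "cmod (lm f) \<le> L * norm f" if "f \<in> ?W" for f
    proof -
      from that obtain l where "?lim f l" by blast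
      with lm lim_bound show ?thesis by metis
    qed
    show "L * norm (f + g) \<le> L * norm f + L * norm g" for f g :: "'a \<Rightarrow>\<^sub>L complex"
      using mult_left_mono[OF norm_triangle_ineq L] by (simp add: distrib_left)
    show "cmul (complex_of_real r) f = r *\<^sub>R f" for r and f :: "'a \<Rightarrow>\<^sub>L complex"
      by (auto intro!: blinfun_eqI simp: blinfun.bilinear_simps scaleR_conv_of_real)
  qed (auto simp: norm_cmul blinfun.bilinear_simps algebra_simps intro!: blinfun_eqI)
  obtain w where w: "\<And>f. clinear f \<Longrightarrow> \<Phi> f = f w"
    using reflexive_representation[of \<Phi>, OF reflexive \<Phi>(1-3)] by blast
  have \<Phi>_lim: "\<Phi> f = l" if "?lim f l" for f l using \<Phi>(4)[of f] lm[OF that] that by blast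
  have "?lim \<phi> 0"
    by (rule tendsto_eventually) (use ev in \<open>eventually_elim, use U(1) in auto\<close>)
  then have "\<phi> w = 0" using \<Phi>_lim w[OF \<phi>_clinear] by metis
  moreover have "a * w = a" if a: "\<phi> a = 0" for a
  proof -
    have conv: "((\<lambda>S. a * U S) \<longlongrightarrow> a) ?F"
    proof (rule tendstoI)
      fix \<epsilon> :: real assume \<epsilon>: "0 < \<epsilon>"
      let ?a = "(2 / \<epsilon>) *\<^sub>R a" \<comment> \<open>rescaling \<open>a\<close> makes the fixed tolerance 1 sufficient\<close>
      have "\<forall>\<^sub>F S in ?F. finite S \<and> S \<subseteq> ?I \<and> ?a \<in> S"
        unfolding eventually_finite_subsets_at_top
        using a by (intro exI[of _ "{?a}"]) (auto simp: blinfun.bilinear_simps)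
      then show "\<forall>\<^sub>F S in ?F. dist (a * U S) a < \<epsilon>"
      proof eventually_elim
        case (elim S)
        then have "norm (?a * U S - ?a) \<le> 1" by (intro U(3)) auto
        moreover have "?a * U S - ?a = (2 / \<epsilon>) *\<^sub>R (a * U S - a)" by (simp add: scaleR_diff_right)
        ultimately have "(2 / \<epsilon>) * norm (a * U S - a) \<le> 1" using \<epsilon> by simp
        then show ?case using \<epsilon> by (simp add: dist_norm field_simps)
      qed
    qed
    have "g (a * w - a) = 0" if g: "clinear g" for g
    proof -
      have cl: "clinear (g o\<^sub>L blinfun_mult_right a)" by (rule clinear_mult[OF g])
      have "((\<lambda>S. g (a * U S)) \<longlongrightarrow> g a) ?F" using conv by (intro blinfun.tendsto tendsto_const)
      then have "?lim (g o\<^sub>L blinfun_mult_right a) (g a)" by simp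
      from \<Phi>_lim[OF this] w[OF cl] show ?thesis by (simp add: blinfun.bilinear_simps)
    qed
    from clinear_separates[OF this] show ?thesis by simp
  qed
  ultimately show thesis by (rule that)
qed

theorem kernel_has_unit:
  assumes reflexive: "reflexive_cspace (cspace_of TYPE('a))"
    and baa: "boundedly_approximately_amenable TYPE('a)"
  obtains w where "\<phi> w = 0" "\<And>a. \<phi> a = 0 \<Longrightarrow> a * w = a"
proof -
  let ?I = "{a. \<phi> a = 0}"
  obtain K where K: "0 \<le> K"
    "\<And>S \<epsilon>. finite S \<Longrightarrow> 0 < \<epsilon> \<Longrightarrow> \<exists>\<xi>\<in>dual_elt predual.
       (\<forall>a. \<forall>T\<in>vcarrier predual. cmod (\<xi> (ract predual T a) - \<xi> (lact predual a T)) \<le> K * norm a * norm T) \<and>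
       (\<forall>a\<in>S. \<forall>T\<in>vcarrier predual.
          cmod (\<xi> (ract predual T a) - \<xi> (lact predual a T) - diag_derivation a T) \<le> \<epsilon> * norm T)"
    using approximate_diagonal[OF baa] by blast
  define L where "L = K * K * norm p"
  \<comment> \<open>The last clause allows every \<open>e\<close> with multiplier bound
    \<open>K\<close>, so that another good element can be inserted for \<open>e\<close>.\<close>
  define good where "good S \<epsilon> u \<longleftrightarrow> \<phi> u = 0 \<and> (\<forall>a. \<phi> a = 0 \<longrightarrow> norm (a * u) \<le> K * norm a) \<and>
    (\<forall>a\<in>S. norm (a * u - a) \<le> \<epsilon>) \<and>
    (\<forall>e. \<phi> e = 0 \<longrightarrow> (\<forall>x. \<phi> x = 0 \<longrightarrow> norm (e * x) \<le> K * norm x) \<longrightarrow>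
       (\<exists>n c. \<phi> n = 0 \<and> 0 \<le> c \<and> (\<forall>a. \<phi> a = 0 \<longrightarrow>
         norm a * norm (e * u) \<le> L * norm a + c * norm (e * a) + norm (a * n))))" for S \<epsilon> u
  have ex_good: "\<exists>u. good S \<epsilon> u" if S: "finite S" "S \<subseteq> ?I" and \<epsilon>: "0 < \<epsilon>" for S \<epsilon>
  proof -
    obtain \<xi> where \<xi>: "\<xi> \<in> dual_elt predual"
      "\<And>a T. T \<in> vcarrier predual \<Longrightarrow> cmod (\<xi> (ract predual T a) - \<xi> (lact predual a T)) \<le> K * norm a * norm T"
      "\<And>a T. a \<in> S \<Longrightarrow> T \<in> vcarrier predual \<Longrightarrow>
          cmod (\<xi> (ract predual T a) - \<xi> (lact predual a T) - diag_derivation a T) \<le> \<epsilon> * norm T"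
      using K(2)[OF S(1) \<epsilon>] by blast
    have "\<And>a. a \<in> S \<Longrightarrow> \<phi> a = 0" "0 \<le> \<epsilon>" using S \<epsilon> by auto
    from element_of_functional[OF reflexive \<xi>(1) K(1) \<xi>(2,3) this]
    obtain u where "\<phi> u = 0" "\<And>a. \<phi> a = 0 \<Longrightarrow> norm (a * u) \<le> K * norm a"
      "\<And>a. a \<in> S \<Longrightarrow> norm (a * u - a) \<le> \<epsilon>"
      "\<And>e. \<phi> e = 0 \<Longrightarrow> (\<And>x. \<phi> x = 0 \<Longrightarrow> norm (e * x) \<le> K * norm x) \<Longrightarrow>
         \<exists>n c. \<phi> n = 0 \<and> 0 \<le> c \<and> (\<forall>a. \<phi> a = 0 \<longrightarrow>
           norm a * norm (e * u) \<le> K * K * norm p * norm a + c * norm (e * a) + norm (a * n))"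
      by blast
    then show ?thesis unfolding good_def L_def by blast
  qed
  have good_mono: "good S \<epsilon> u" if "good T \<delta> u" "S \<subseteq> T" "\<delta> \<le> \<epsilon>" for S T \<delta> \<epsilon> u
    using that unfolding good_def by (meson order_trans subset_iff)
  show thesis
  \<comment> \<open>The cases ask whether the good elements, directed by \<open>S\<close> and
    \<epsilon>, form a Cauchy net.\<close>
  proof (cases "\<forall>\<delta>>0. \<exists>S \<epsilon>. finite S \<and> S \<subseteq> ?I \<and> 0 < \<epsilon> \<and>
      (\<forall>w w'. good S \<epsilon> w \<longrightarrow> good S \<epsilon> w' \<longrightarrow> norm (w - w') < \<delta>)")
    case True
    then have "\<forall>m. \<exists>S \<epsilon>. finite S \<and> S \<subseteq> ?I \<and> 0 < \<epsilon> \<and>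
      (\<forall>w w'. good S \<epsilon> w \<longrightarrow> good S \<epsilon> w' \<longrightarrow> norm (w - w') < 1 / real (Suc m))"
      by simp
    then obtain S \<epsilon> where S: "\<And>m. finite (S m)" "\<And>m. S m \<subseteq> ?I" "\<And>m. 0 < \<epsilon> m"
      and close: "\<And>m w w'. good (S m) (\<epsilon> m) w \<Longrightarrow> good (S m) (\<epsilon> m) w' \<Longrightarrow> norm (w - w') < 1 / real (Suc m)"
      by metis
    \<comment> \<open>Accumulated sets and minimal tolerances make \<open>w m\<close> good for all
      indices up to m. The extra entry \<open>1 / real (Suc m)\<close> in \<delta> makes the
      approximation error tend to 0.\<close>
    define T where "T m = (\<Union>k\<le>m. S k)" for m
    define \<delta> where "\<delta> m = Min (insert (1 / real (Suc m)) (\<epsilon> ` {..m}))" for m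
    have T: "finite (T m)" "T m \<subseteq> ?I" "k \<le> m \<Longrightarrow> S k \<subseteq> T m" for k m
      using S by (auto simp: T_def)
    have \<delta>: "0 < \<delta> m" "k \<le> m \<Longrightarrow> \<delta> m \<le> \<epsilon> k" for k m
      using S(3) by (simp add: \<delta>_def) (unfold \<delta>_def, intro Min_le; simp)
    have "\<exists>w. good (T m) (\<delta> m) w" for m using ex_good[OF T(1,2) \<delta>(1)] .
    then obtain w where w: "\<And>m. good (T m) (\<delta> m) (w m)" by metis
    have wk: "good (S k) (\<epsilon> k) (w m)" if "k \<le> m" for k m
      by (rule good_mono[OF w T(3)[OF that] \<delta>(2)[OF that]])
    have "Cauchy w"
    proof (rule metric_CauchyI)
      fix r :: real assume "0 < r"
      then obtain k where k: "1 / real (Suc k) < r" using nat_approx_posE by metis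
      have "dist (w m) (w n) < r" if "k \<le> m" "k \<le> n" for m n
        using close[OF wk[OF that(1)] wk[OF that(2)]] k by (simp add: dist_norm)
      then show "\<exists>M. \<forall>m\<ge>M. \<forall>n\<ge>M. dist (w m) (w n) < r" by blast
    qed
    then obtain v where v: "w \<longlonglongrightarrow> v" using Cauchy_convergent_iff convergent_def by blast
    have "(\<lambda>m. \<phi> (w m)) \<longlonglongrightarrow> \<phi> v" by (intro blinfun.tendsto tendsto_const v)
    moreover have "\<phi> (w m) = 0" for m using w by (simp add: good_def)
    ultimately have \<phi>v: "\<phi> v = 0" by (simp add: LIMSEQ_const_iff)
    have "a * v = a" if a: "\<phi> a = 0" for a
    proof -
      have bound: "norm (a * w m - a) \<le> (norm a + 1) * (1 / real (Suc m))" for m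
      proof -
        \<comment> \<open>The given \<open>a\<close> need not lie in any \<open>T m\<close>, so
          \<open>w m\<close> is compared with a nearby good element that does approximate a unit at
          \<open>a\<close>.\<close>
        obtain w' where w': "good (insert a (T m)) (\<delta> m) w'"
          using ex_good[of "insert a (T m)" "\<delta> m"] T \<delta>(1) a by auto
        have "good (S m) (\<epsilon> m) w'"
          by (rule good_mono[OF w']) (use T(3)[of m m] \<delta>(2)[of m m] in auto)
        then have 1: "norm (w m - w') < 1 / real (Suc m)" by (intro close wk) auto
        have "norm (a * w' - a) \<le> \<delta> m" using w' by (simp add: good_def)
        also have "\<delta> m \<le> 1 / real (Suc m)" unfolding \<delta>_def by (intro Min_le) auto
        finally have 2: "norm (a * w' - a) \<le> 1 / real (Suc m)" .
        have "norm (a * (w m - w')) \<le> norm a * norm (w m - w')" by (rule norm_mult_ineq)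
        also have "\<dots> \<le> norm a * (1 / real (Suc m))" using 1 by (intro mult_left_mono) auto
        finally have 3: "norm (a * (w m - w')) \<le> norm a * (1 / real (Suc m))" .
        have "norm (a * w m - a) = norm (a * (w m - w') + (a * w' - a))"
          by (simp add: right_diff_distrib)
        also have "\<dots> \<le> norm a * (1 / real (Suc m)) + 1 / real (Suc m)"
          by (intro order_trans[OF norm_triangle_ineq] add_mono 2 3)
        also have "\<dots> = (norm a + 1) * (1 / real (Suc m))" by (simp only: distrib_right mult_1_left)
        finally show ?thesis .
      qed
      have "(\<lambda>m. (norm a + 1) * (1 / real (Suc m))) \<longlonglongrightarrow> (norm a + 1) * 0"
        by (intro tendsto_intros LIMSEQ_Suc[OF lim_1_over_n])
      then have "(\<lambda>m. a * w m - a) \<longlonglongrightarrow> 0"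
        using bound by (intro Lim_null_comparison[of "\<lambda>m. a * w m - a"] always_eventually) auto
      moreover have "(\<lambda>m. a * w m - a) \<longlonglongrightarrow> a * v - a" by (intro tendsto_intros v)
      ultimately show ?thesis using LIMSEQ_unique by fastforce
    qed
    with \<phi>v show thesis by (rule that)
  next
    case False
    then obtain \<delta> where \<delta>: "0 < \<delta>" and far: "\<And>S \<epsilon>. finite S \<Longrightarrow> S \<subseteq> ?I \<Longrightarrow> 0 < \<epsilon> \<Longrightarrow>
      \<exists>w w'. good S \<epsilon> w \<and> good S \<epsilon> w' \<and> \<delta> \<le> norm (w - w')"
      by (meson not_less)
    have e_bound: "norm (e * u) \<le> L"
      if u: "good S \<epsilon> u" and e: "\<phi> e = 0" "\<And>x. \<phi> x = 0 \<Longrightarrow> norm (e * x) \<le> K * norm x" for S \<epsilon> u e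
    proof -
      obtain n c where n: "\<phi> n = 0" and c: "0 \<le> c"
        and nc: "\<And>a. \<phi> a = 0 \<Longrightarrow> norm a * norm (e * u) \<le> L * norm a + c * norm (e * a) + norm (a * n)"
        using u e unfolding good_def by blast
      show ?thesis
      proof (rule field_le_epsilon)
        fix r :: real assume r: "0 < r"
        \<comment> \<open>Chosen so that the error \<open>c * (2 * \<eta>) + 2 * \<eta>\<close>
          equals \<open>r * \<delta>\<close>, which is at most \<open>r * norm a\<close> since
          \<open>a\<close> has norm at least \<delta>.\<close>
        define \<eta> where "\<eta> = r * \<delta> / (2 * (c + 1))"
        have \<eta>: "0 < \<eta>" using r \<delta> c by (simp add: \<eta>_def)
        obtain w w' where w: "good {e, n} \<eta> w" "good {e, n} \<eta> w'" "\<delta> \<le> norm (w - w')"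
          using far[of "{e, n}" \<eta>] e n \<eta> by auto
        \<comment> \<open>Both \<open>x * w\<close> and \<open>x * w'\<close> are close to
          \<open>x\<close> for \<open>x\<close> in \<open>{e, n}\<close>, so \<open>a\<close> nearly
          annihilates both elements while its norm stays above \<delta>.\<close>
        define a where "a = w - w'"
        have small: "norm (x * a) \<le> 2 * \<eta>" if "x \<in> {e, n}" for x
        proof -
          have "norm (x * w - x) \<le> \<eta>" "norm (x * w' - x) \<le> \<eta>" using w that by (auto simp: good_def)
          moreover have "x * a = (x * w - x) - (x * w' - x)" by (simp add: a_def right_diff_distrib)
          ultimately show ?thesis using norm_triangle_ineq4[of "x * w - x" "x * w' - x"] by simp
        qed
        have "\<phi> a = 0" unfolding a_def using w by (intro kernel_diff) (auto simp: good_def)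
        from nc[OF this] have "norm a * norm (e * u) \<le> L * norm a + c * (2 * \<eta>) + 2 * \<eta>"
          using mult_left_mono[OF small[of e] c] small[of n] commute[of n a] by simp
        also have "\<dots> = L * norm a + r * \<delta>"
        proof -
          have "c * (2 * \<eta>) + 2 * \<eta> = 2 * (c + 1) * \<eta>" by (simp add: algebra_simps)
          also have "\<dots> = r * \<delta>" using c by (simp add: \<eta>_def)
          finally show ?thesis by simp
        qed
        also have "\<dots> \<le> L * norm a + r * norm a"
          using w(3) r by (simp add: a_def)
        finally have "norm a * norm (e * u) \<le> norm a * (L + r)" by (simp add: algebra_simps)
        moreover have "0 < norm a" using w(3) \<delta> unfolding a_def by linarith
        ultimately show "norm (e * u) \<le> L + r" by (simp add: mult_le_cancel_left_pos)
      qed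
    qed
    have u_bound: "norm u \<le> L" if u: "good S \<epsilon> u" for S \<epsilon> u
    proof (rule field_le_epsilon)
      fix r :: real assume r: "0 < r"
      have \<phi>u: "\<phi> u = 0" using u by (simp add: good_def)
      \<comment> \<open>Here \<open>e\<close> approximates a unit at \<open>u\<close> itself, so the
        bound on \<open>e * u\<close> passes to \<open>u\<close> up to \<open>r\<close>. As a good
        element \<open>e\<close> has the required multiplier bound.\<close>
      obtain e where e: "good {u} r e" using ex_good[of "{u}" r] \<phi>u r by auto
      have "norm (e * u) \<le> L"
      proof (rule e_bound[OF u])
        show "\<phi> e = 0" using e by (simp add: good_def)
        show "norm (e * x) \<le> K * norm x" if "\<phi> x = 0" for x
          using e that commute[of e x] by (simp add: good_def)
      qed
      moreover have "norm (u * e - u) \<le> r" using e by (simp add: good_def)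
      ultimately show "norm u \<le> L + r"
        using norm_triangle_ineq4[of "u * e" "u * e - u"] commute[of u e] by simp
    qed
    have "\<exists>u. \<phi> u = 0 \<and> norm u \<le> L \<and> (\<forall>a\<in>S. norm (a * u - a) \<le> 1)"
      if S: "finite S" "S \<subseteq> ?I" for S
    proof -
      obtain u where u: "good S 1 u" using ex_good[OF S, of 1] by auto
      with u_bound[OF u] show ?thesis by (auto simp: good_def)
    qed
    then show thesis
      using unit_of_bounded_approximate_identity[OF reflexive] that by blast
  qed
qed

end

theorem theorem5p3:
  assumes commutative: "\<forall>a b :: 'a::complex_banach_algebra. a * b = b * a"
    and baa: "boundedly_approximately_amenable TYPE('a)"
    and reflexive: "reflexive_cspace (cspace_of TYPE('a))"
  shows "complex_finite_dimensional TYPE('a)"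
proof -
  \<comment> \<open>For \<phi> = 0 the kernel is the whole algebra, so its unit is a unit of
    \<open>A\<close>.\<close>
  interpret zero: augmentation "0 :: 'a \<Rightarrow>\<^sub>L complex" id_blinfun
    by unfold_locales (use commutative in \<open>auto simp: clinear_zero\<close>)
  obtain e :: 'a where e: "\<And>a. a * e = a"
    using zero.kernel_has_unit[OF reflexive baa] by auto
  interpret unital_commutative e
    by unfold_locales (use commutative e in metis)+
  show ?thesis
  proof (rule finite_dimensional_criterion)
    fix \<phi> :: "'a \<Rightarrow> complex" assume \<phi>: "character \<phi>"
    then have add: "\<phi> (x + y) = \<phi> x + \<phi> y" and scale: "\<phi> (c *\<^sub>C x) = c * \<phi> x"
      and mult: "\<phi> (x * y) = \<phi> x * \<phi> y" and one: "\<phi> e = 1" for x y c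
      by (auto simp: character_def cfunctional_def)
    obtain C where C: "\<And>x. cmod (\<phi> x) \<le> C * norm x"
      using \<phi> by (auto simp: character_def cfunctional_def)
    have bl: "bounded_linear \<phi>"
      by (rule bounded_linear_intro[where K = C])
        (use C in \<open>auto simp: add scale scaleR_scaleC scaleR_conv_of_real mult.commute\<close>)
    have blp: "bounded_linear (\<lambda>a. a - \<phi> a *\<^sub>C e)"
    proof (rule bounded_linear_sub[OF bounded_linear_ident], rule bounded_linear_intro[where K = "C * norm e"])
      show "norm (\<phi> x *\<^sub>C e) \<le> norm x * (C * norm e)" for x
        using mult_right_mono[OF C norm_ge_zero, of x e] by (simp add: norm_scaleC mult_ac)
    qed (auto simp: add scale scaleC_add_left scaleR_scaleC scaleC_scaleC)
    \<comment> \<open>The projection onto the kernel along \<open>e\<close>, available now that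
      \<open>A\<close> has a unit.\<close>
    define p where "p = Blinfun (\<lambda>a. a - \<phi> a *\<^sub>C e)"
    have p: "blinfun_apply p = (\<lambda>a. a - \<phi> a *\<^sub>C e)" and \<phi>': "blinfun_apply (Blinfun \<phi>) = \<phi>"
      using bl blp by (simp_all add: p_def bounded_linear_Blinfun_apply)
    interpret aug: augmentation "Blinfun \<phi>" p
    proof
      show "Blinfun \<phi> (p a) = 0" for a
        using add[of "a - \<phi> a *\<^sub>C e" "\<phi> a *\<^sub>C e"] by (simp add: p \<phi>' scale one)
    qed (simp_all add: p \<phi>' commute clinear_def scale mult mult_scaleC_left mult_scaleC_right
        scaleC_scaleC complex_vector.scale_right_diff_distrib right_diff_distrib mult.commute)
    obtain w where w: "\<phi> w = 0" "\<And>a. \<phi> a = 0 \<Longrightarrow> a * w = a"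
      using aug.kernel_has_unit[OF reflexive baa] unfolding \<phi>' by blast
    \<comment> \<open>The kernel component \<open>a - \<phi> a *\<^sub>C e\<close> is fixed by
      \<open>w\<close> and hence annihilated by \<open>e - w\<close>, which leaves the scalar
      part.\<close>
    have "a * (e - w) = \<phi> a *\<^sub>C (e - w)" for a
    proof -
      have "\<phi> (a - \<phi> a *\<^sub>C e) = 0" using aug.\<phi>_p[of a] by (simp add: p \<phi>')
      from w(2)[OF this] show ?thesis
        by (simp add: left_diff_distrib right_diff_distrib mult_scaleC_left
            complex_vector.scale_right_diff_distrib algebra_simps)
    qed
    moreover have "\<phi> (e - w) = 1" using add[of "e - w" w] w one by simp
    ultimately show "\<exists>q. \<phi> q = 1 \<and> (\<forall>a. a * q = \<phi> a *\<^sub>C q)" by blast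
  qed
qed

end
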